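(* The algebra $\mathcal{H}:=\mathbb{C}[h_1,h_2,h_3,\ldots]$ is closed under the action of $D:=q\frac{\partial}{\partial q}$. Moreover, for $k\in\mathbb{N}$ we have $$D(h_k)=\frac{h_{k+2}}6-\frac16\sum_{d=0}^{k}\binom{k}{d}h_{d+1}\,h_{k-d+1},\qquad \frac{h_2}6-\frac{h_1^2}6=G_2 .$$ Further, $\mathcal{H}=\widetilde{\mathcal{M}}[h_1,h_3,h_5,\ldots]$, where $\widetilde{\mathcal{M}}:=\mathbb{C}[G_2,G_4,G_6]$ is the space of quasimodular forms; that is, $\mathcal{H}$ is the algebra generated over $\widetilde{\mathcal{M}}$ by the $h_k$ with $k$ odd.
   Context: $\mathbb{N}=\{1,2,\dots\}$, $\tau$ lies in the complex upper half-plane $\mathbb{H}$, $q:=e^{2\pi i\tau}$, $\zeta:=e^{2\pi i z}$, with $q^{r}:=e^{2\pi i r\tau}$ for $r\in\mathbb{Q}$; thus $D=\frac1{2\pi i}\frac{d}{d\tau}$ on functions of $\tau$. $\eta(\tau):=q^{\frac1{24}}\prod_{n\ge1}(1-q^n)$. For even $k\in\mathbb{N}$, $G_k(\tau):=-\frac{B_k}{2k}+\sum_{n\ge1}\sigma_{k-1}(n)q^n$, where $B_k$ is the $k$-th Bernoulli number and $\sigma_{k-1}(n):=\sum_{d\mid n}d^{k-1}$. False theta function: $h(\zeta;q):=(1-\zeta)\sum_{n\ge0}(-1)^n\zeta^{3n}q^{\frac{n(3n+1)}2}\left(1-\zeta^2q^{2n+1}\right)$. The false Eisenstein series $h_k$,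 $k\in\mathbb{N}$, are the functions on $\mathbb{H}$ defined by the expansion around $z=0$ $$h(\zeta;q)=-2i\sin(\pi z)\,q^{-\frac1{24}}\eta(\tau)\exp\left(-\sum_{k\ge1}h_k(\tau)\frac{(2\pi i z)^k}{k!}\right).$$ $\mathbb{C}[h_1,h_2,\dots]$ denotes the $\mathbb{C}$-algebra of functions generated by the $h_k$ (no algebraic independence is asserted). *)

theory Defs
  imports "HOL-Complex_Analysis.Complex_Analysis"
begin

definition upper_half_plane :: "complex set" (\<open>\<H>\<close>) where
  "\<H> = {\<tau>. Im \<tau> > 0}"

text \<open>\<open>qpow r \<tau>\<close> is \<open>q\<^sup>r = exp (2 \<pi> i r \<tau>)\<close>, so that \<open>qpow 1 \<tau>\<close> is the nome \<open>q\<close>.\<close>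

definition qpow :: "rat \<Rightarrow> complex \<Rightarrow> complex" where
  "qpow r \<tau> = exp (2 * of_real pi * \<i> * of_rat r * \<tau>)"

definition dedekind_eta :: "complex \<Rightarrow> complex" where
  "dedekind_eta \<tau> = qpow (1/24) \<tau> * (\<Prod>n. 1 - qpow 1 \<tau> ^ Suc n)"

text \<open>
  Bernoulli numbers, from \<open>x / (exp x - 1) = (\<Sum>k. B\<^sub>k x\<^sup>k / k!)\<close>. Only even \<open>k \<ge> 2\<close> matter
  below, so the sign convention for \<open>B\<^sub>1\<close> is irrelevant.
\<close>

definition bernoulli :: "nat \<Rightarrow> complex" where
  "bernoulli k = fact k * fps_nth (fps_X / (fps_exp 1 - 1)) k"

definition divisor_power_sum :: "nat \<Rightarrow> nat \<Rightarrow> nat" where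
  "divisor_power_sum m n = (\<Sum>d | d dvd n. d ^ m)"

text \<open>Meant for even \<open>k \<ge> 2\<close>; the series starts at exponent 1, hence the \<open>Suc\<close>.\<close>

definition eisenstein_G :: "nat \<Rightarrow> complex \<Rightarrow> complex" where
  "eisenstein_G k \<tau> =
     - bernoulli k / (2 * of_nat k)
     + (\<Sum>n. of_nat (divisor_power_sum (k - 1) (Suc n)) * qpow 1 \<tau> ^ Suc n)"

definition false_theta :: "complex \<Rightarrow> complex \<Rightarrow> complex" where
  "false_theta \<zeta> q =
     (1 - \<zeta>) * (\<Sum>n. (-1) ^ n * \<zeta> ^ (3 * n) * q ^ (n * (3 * n + 1) div 2)
                        * (1 - \<zeta>\<^sup>2 * q ^ (2 * n + 1)))"

text \<open>
  \<open>false_eisenstein_expansion \<tau> a\<close>: for \<open>z\<close> near \<open>0\<close> the series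
  \<open>\<Sum>\<^bsub>k\<ge>1\<^esub> a\<^sub>k (2 \<pi> i z)\<^sup>k / k!\<close> converges and, writing \<open>S\<close> for its sum,
  \<open>h(\<zeta>;q) = -2i sin (\<pi> z) q\<^sup>-\<^sup>1\<^sup>/\<^sup>2\<^sup>4 \<eta>(\<tau>) exp (- S)\<close>. The sum has no term for \<open>k = 0\<close>;
  the value \<open>a 0\<close>, which has no counterpart, is normalised to \<open>0\<close> so that \<open>a\<close> is unique
  as a function on \<open>nat\<close>.
\<close>

definition false_eisenstein_expansion :: "complex \<Rightarrow> (nat \<Rightarrow> complex) \<Rightarrow> bool" where
  "false_eisenstein_expansion \<tau> a \<longleftrightarrow>
     a 0 = 0 \<and>
     (\<forall>\<^sub>F z in nhds 0. \<exists>S.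
        (\<lambda>k. a (Suc k) * (2 * of_real pi * \<i> * z) ^ Suc k / fact (Suc k)) sums S \<and>
        false_theta (exp (2 * of_real pi * \<i> * z)) (qpow 1 \<tau>) =
          - 2 * \<i> * sin (of_real pi * z) * qpow (- 1/24) \<tau> * dedekind_eta \<tau> * exp (- S))"

definition false_eisenstein :: "nat \<Rightarrow> complex \<Rightarrow> complex" where
  "false_eisenstein k \<tau> = (THE a. false_eisenstein_expansion \<tau> a) k"

text \<open>
  Functions on \<open>\<H>\<close> are represented by functions on \<open>complex\<close> that are \<open>undefined\<close> outside
  \<open>\<H>\<close> (\<open>restrict\<close>), so that equality is equality on \<open>\<H>\<close>.
  \<open>fun_algebra X\<close> is the \<open>\<complex>\<close>-algebra of functions on \<open>\<H>\<close> generated by \<open>X\<close>.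
\<close>

inductive_set fun_algebra :: "(complex \<Rightarrow> complex) set \<Rightarrow> (complex \<Rightarrow> complex) set"
  for X :: "(complex \<Rightarrow> complex) set" where
  const: "(\<lambda>\<tau>\<in>\<H>. c) \<in> fun_algebra X"
| gen: "f \<in> X \<Longrightarrow> restrict f \<H> \<in> fun_algebra X"
| add: "f \<in> fun_algebra X \<Longrightarrow> g \<in> fun_algebra X \<Longrightarrow> (\<lambda>\<tau>\<in>\<H>. f \<tau> + g \<tau>) \<in> fun_algebra X"
| mult: "f \<in> fun_algebra X \<Longrightarrow> g \<in> fun_algebra X \<Longrightarrow> (\<lambda>\<tau>\<in>\<H>. f \<tau> * g \<tau>) \<in> fun_algebra X"

definition false_eisenstein_algebra :: "(complex \<Rightarrow> complex) set" where
  "false_eisenstein_algebra = fun_algebra {false_eisenstein k | k. k \<ge> 1}"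

definition quasimodular_forms :: "(complex \<Rightarrow> complex) set" where
  "quasimodular_forms = fun_algebra {eisenstein_G 2, eisenstein_G 4, eisenstein_G 6}"

text \<open>
  \<open>D = q \<partial>/\<partial>q = (2 \<pi> i)\<^sup>-\<^sup>1 d/d\<tau>\<close>. As \<open>\<H>\<close> is open, the derivative at a point of \<open>\<H>\<close> does
  not depend on the values outside \<open>\<H>\<close>.
\<close>

definition qD :: "(complex \<Rightarrow> complex) \<Rightarrow> complex \<Rightarrow> complex" where
  "qD f = (\<lambda>\<tau>\<in>\<H>. deriv f \<tau> / (2 * of_real pi * \<i>))"

end

theory Submission
  imports Defs "HOL-Real_Asymp.Real_Asymp"
begin

text \<open>
  Write \<open>u = 2 \<pi> i z\<close>. Euler's pentagonal number theorem gives
  \<open>T = \<eta> exp (- \<Sum> h\<^sub>k u\<^sup>k / k!)\<close>, where \<open>T = \<Sum> \<chi>(m) q\<^bsup>m\<^sup>2/24\<^esup> e\<^bsup>m u/2\<^esup>\<close> (sum over \<open>m \<ge> 1\<close>) is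
  a partial theta series. Each of its terms satisfies the heat equation \<open>6 D T = T''\<close>, and comparing
  Taylor coefficients of the logarithmic derivative yields the formula for \<open>D h\<^sub>k\<close>, the
  coefficient at \<open>u = 0\<close> being \<open>D \<eta> = - G\<^sub>2 \<eta>\<close>. Hence \<open>G\<^sub>2\<close> lies in the algebra generated by the
  \<open>h\<^sub>k\<close>, and Ramanujan's formulas for \<open>D G\<^sub>2\<close> and \<open>D G\<^sub>4\<close> put \<open>G\<^sub>4\<close> and \<open>G\<^sub>6\<close> there as well.
  Conversely, the formula for \<open>D h\<^sub>k\<close> with \<open>k\<close> even expresses \<open>h\<^bsub>k+2\<^esub>\<close> by \<open>D h\<^sub>k\<close>
  and smaller indices, and quasimodular forms are closed under \<open>D\<close>.

  Ramanujan's formulas, in terms of \<open>S\<^sub>j = \<Sum> n\<^sup>j u\<^sub>n\<close> with \<open>u\<^sub>n = q\<^sup>n / (1 - q\<^sup>n)\<close>, come from the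
  addition formula \<open>u\<^sub>a u\<^sub>b = u\<^bsub>a+b\<^esub> (1 + u\<^sub>a + u\<^sub>b)\<close> by rearranging double sums over pairs \<open>(a, b)\<close>.
\<close>

subsection \<open>Lambert series and Ramanujan's differential equations\<close>

text \<open>Dividing \<open>h\<close> by \<open>1 - \<zeta>\<close> and multiplying by
  \<open>\<zeta>^(1/2) q^(1/24)\<close> completes the squares in the exponents. The heat equation is
  then just \<open>6 * m^2/24 = (m/2)^2\<close>. Being linear, it survives the restriction to
  \<open>m \<ge> 1\<close>, which destroys the modular behaviour of a full theta series.

  For each fixed \<tau>, \<open>T\<close> and its logarithmic derivative are treated as formal power
  series in \<open>u\<close>, and \<open>D\<close> acts on one Taylor coefficient at a time. Only
  termwise differentiation in \<tau> is required, never joint holomorphy in \<open>z\<close> and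
  \<tau>. The logarithmic derivative exists formally because the constant coefficient \<eta> has no
  zero on \<H>.

  The obstacle in Ramanujan's formulas is \<open>D G_6\<close>: Liouville's identity for
  \<open>x^6\<close> involves \<open>S_7\<close> and \<open>S_3^2\<close> besides
  \<open>D S_5\<close>. Another choice of weights in the same double sum expresses
  \<open>S_7\<close> by \<open>S_3\<close>, so that neither modular transformations nor dimension
  formulas enter.\<close>

lemma summable_power_exp:
  fixes y :: real
  assumes "y > 0"
  shows "summable (\<lambda>n. real n ^ k * exp (- y * real n))"
proof (rule summable_comparison_test_bigo)
  show "summable (\<lambda>n. norm (1 / real n ^ 2))"
    using inverse_power_summable[of 2, where 'a = real] by (simp add: inverse_eq_divide)
  show "(\<lambda>n. real n ^ k * exp (- y * real n)) \<in> O(\<lambda>n. 1 / real n ^ 2)"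
    using assms by real_asymp
qed

lemma summable_power_geometric:
  fixes r :: real
  assumes "0 \<le> r" "r < 1"
  shows "summable (\<lambda>n. real n ^ k * r ^ n)"
proof (cases "r = 0")
  case True
  have "(\<lambda>n. real n ^ k * r ^ n) = (\<lambda>n. if n = 0 then real n ^ k else 0)"
    using True by (auto simp: fun_eq_iff)
  then show ?thesis by (simp add: summable_If_finite)
next
  case False
  have "r ^ n = exp (- (- ln r) * real n)" for n
    using assms False by (simp add: exp_of_nat_mult mult.commute)
  then show ?thesis
    using summable_power_exp[of "- ln r" k] assms False by simp
qed

section \<open>Lambert sums and double sums over pairs of positive integers\<close>

definition lambert_term :: "complex \<Rightarrow> nat \<Rightarrow> complex" where
  "lambert_term q n = q ^ n / (1 - q ^ n)"

definition lambert_sum :: "nat \<Rightarrow> complex \<Rightarrow> complex" where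
  "lambert_sum j q = (\<Sum>\<^sub>\<infinity>n\<in>{1..}. of_nat n ^ j * lambert_term q n)"

definition pos_pairs :: "(nat \<times> nat) set" where
  "pos_pairs = {1..} \<times> {1..}"

text \<open>The weight takes complex arguments so that differences such as \<open>a - b\<close> are
  not truncated and identities between weights are plain ring identities.\<close>

definition pair_sum :: "complex \<Rightarrow> (complex \<Rightarrow> complex \<Rightarrow> complex) \<Rightarrow> complex" where
  "pair_sum q w =
     (\<Sum>\<^sub>\<infinity>(a, b)\<in>pos_pairs. w (of_nat a) (of_nat b) * lambert_term q a * lambert_term q b)"

text \<open>A bound by a power of \<open>a * b\<close>, rather than of \<open>a + b\<close>, is
  stable under products and lets the majorant of the double series factor into two single
  series.\<close>

definition poly_bounded :: "(complex \<Rightarrow> complex \<Rightarrow> complex) \<Rightarrow> bool" where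
  "poly_bounded w \<longleftrightarrow> (\<exists>C k. C \<ge> 0 \<and> (\<forall>a\<ge>1. \<forall>b\<ge>1.
     norm (w (of_nat a) (of_nat b)) \<le> C * (real a * real b) ^ k))"

lemma poly_boundedE:
  assumes "poly_bounded w"
  obtains C k where "C \<ge> 0"
    "\<And>a b. a \<ge> 1 \<Longrightarrow> b \<ge> 1 \<Longrightarrow> norm (w (of_nat a) (of_nat b)) \<le> C * (real a * real b) ^ k"
  using assms unfolding poly_bounded_def by blast

lemma poly_bounded_const [intro!]: "poly_bounded (\<lambda>x y. c)"
  unfolding poly_bounded_def by (rule exI[of _ "norm c"], rule exI[of _ 0]) auto

lemma poly_bounded_fst [intro!]: "poly_bounded (\<lambda>x y. x)"
  unfolding poly_bounded_def by (rule exI[of _ 1], rule exI[of _ 1]) auto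

lemma poly_bounded_snd [intro!]: "poly_bounded (\<lambda>x y. y)"
  unfolding poly_bounded_def by (rule exI[of _ 1], rule exI[of _ 1]) auto

lemma poly_bounded_mult [intro!]:
  assumes "poly_bounded v" "poly_bounded w"
  shows "poly_bounded (\<lambda>x y. v x y * w x y)"
proof -
  obtain C k D l where C: "C \<ge> 0" "D \<ge> 0"
    "\<And>a b. a \<ge> 1 \<Longrightarrow> b \<ge> 1 \<Longrightarrow> norm (v (of_nat a) (of_nat b)) \<le> C * (real a * real b) ^ k"
    "\<And>a b. a \<ge> 1 \<Longrightarrow> b \<ge> 1 \<Longrightarrow> norm (w (of_nat a) (of_nat b)) \<le> D * (real a * real b) ^ l"
    using assms by (elim poly_boundedE) blast
  show ?thesis unfolding poly_bounded_def
  proof (rule exI[of _ "C * D"], rule exI[of _ "k + l"], intro conjI allI impI)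
    fix a b :: nat assume ab: "a \<ge> 1" "b \<ge> 1"
    have "norm (v (of_nat a) (of_nat b) * w (of_nat a) (of_nat b))
        \<le> (C * (real a * real b) ^ k) * (D * (real a * real b) ^ l)"
      unfolding norm_mult using C ab by (intro mult_mono) auto
    then show "norm (v (of_nat a) (of_nat b) * w (of_nat a) (of_nat b))
        \<le> C * D * (real a * real b) ^ (k + l)"
      by (simp add: power_add mult_ac)
  qed (use C in auto)
qed

lemma poly_bounded_add [intro!]:
  assumes "poly_bounded v" "poly_bounded w"
  shows "poly_bounded (\<lambda>x y. v x y + w x y)"
proof -
  obtain C k D l where C: "C \<ge> 0" "D \<ge> 0"
    "\<And>a b. a \<ge> 1 \<Longrightarrow> b \<ge> 1 \<Longrightarrow> norm (v (of_nat a) (of_nat b)) \<le> C * (real a * real b) ^ k"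
    "\<And>a b. a \<ge> 1 \<Longrightarrow> b \<ge> 1 \<Longrightarrow> norm (w (of_nat a) (of_nat b)) \<le> D * (real a * real b) ^ l"
    using assms by (elim poly_boundedE) blast
  show ?thesis unfolding poly_bounded_def
  proof (rule exI[of _ "C + D"], rule exI[of _ "k + l"], intro conjI allI impI)
    fix a b :: nat assume ab: "a \<ge> 1" "b \<ge> 1"
    define t where "t = real a * real b"
    have "t \<ge> 1" using ab mult_mono[of 1 "real a" 1 "real b"] by (simp add: t_def)
    then have "C * t ^ k \<le> C * t ^ (k + l)" "D * t ^ l \<le> D * t ^ (k + l)"
      using C by (auto intro!: mult_left_mono power_increasing)
    then show "norm (v (of_nat a) (of_nat b) + w (of_nat a) (of_nat b))
        \<le> (C + D) * (real a * real b) ^ (k + l)"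
      using C(3,4)[OF ab] norm_triangle_ineq[of "v (of_nat a) (of_nat b)" "w (of_nat a) (of_nat b)"]
      by (simp add: t_def[symmetric] distrib_right)
  qed (use C in auto)
qed

lemma poly_bounded_power [intro!]:
  "poly_bounded w \<Longrightarrow> poly_bounded (\<lambda>x y. w x y ^ n)"
  by (induction n) auto

lemma poly_bounded_diff [intro!]:
  "poly_bounded v \<Longrightarrow> poly_bounded w \<Longrightarrow> poly_bounded (\<lambda>x y. v x y - w x y)"
  using poly_bounded_add[OF _ poly_bounded_mult[OF poly_bounded_const[of "-1"]], of v w] by simp

context
  fixes q :: complex
  assumes q: "norm q < 1"
begin

lemma norm_lambert_term_le:
  assumes "n \<ge> 1"
  shows "norm (lambert_term q n) \<le> norm q ^ n / (1 - norm q)"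
proof -
  have "norm q ^ n \<le> norm q ^ 1"
    using assms q by (intro power_decreasing) auto
  moreover have "1 - norm q ^ n \<le> norm (1 - q ^ n)"
    using norm_triangle_ineq2[of 1 "q ^ n"] by (simp add: norm_power)
  ultimately show ?thesis
    using q unfolding lambert_term_def norm_divide norm_power
    by (intro divide_left_mono mult_pos_pos) (auto intro: frac_le)
qed

lemma one_minus_power_nonzero:
  assumes "n \<ge> 1"
  shows "1 - q ^ n \<noteq> 0"
proof
  assume "1 - q ^ n = 0"
  then have "norm q ^ n = 1" by (metis eq_iff_diff_eq_0 norm_one norm_power)
  moreover have "norm q ^ n \<le> norm q ^ 1"
    using assms q by (intro power_decreasing) auto
  ultimately show False using q by simp
qed

lemma summable_lambert:
  "(\<lambda>n. of_nat n ^ j * lambert_term q n) summable_on {1..}"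
proof (rule Infinite_Sum.abs_summable_summable, rule Infinite_Sum.abs_summable_on_comparison_test')
  show "(\<lambda>n. real n ^ j * norm q ^ n / (1 - norm q)) summable_on {1..}"
  proof (rule summable_on_subset[of _ UNIV])
    have "summable (\<lambda>n. real n ^ j * norm q ^ n / (1 - norm q))"
      by (intro summable_divide summable_power_geometric) (use q in auto)
    then show "(\<lambda>n. real n ^ j * norm q ^ n / (1 - norm q)) summable_on UNIV"
      by (rule summable_nonneg_imp_summable_on) (use q in auto)
  qed auto
  show "norm (of_nat n ^ j * lambert_term q n) \<le> real n ^ j * norm q ^ n / (1 - norm q)"
    if "n \<in> {1..}" for n
    using mult_left_mono[OF norm_lambert_term_le[of n], of "real n ^ j"] that
    by (simp add: norm_mult norm_power)
qed

lemma has_sum_lambert: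
  "((\<lambda>n. of_nat n ^ j * lambert_term q n) has_sum lambert_sum j q) {1..}"
  unfolding lambert_sum_def by (intro has_sum_infsum summable_lambert)

lemma summable_pairs_majorant:
  "(\<lambda>(a, b). (real a * real b) ^ k * norm q ^ (a + b)) summable_on pos_pairs"
  unfolding pos_pairs_def
proof (rule summable_on_SigmaI)
  define s where "s = (\<Sum>\<^sub>\<infinity>n\<in>{1..}. real n ^ k * norm q ^ n)"
  have S: "((\<lambda>n. real n ^ k * norm q ^ n) has_sum s) {1..}"
    unfolding s_def
  proof (rule has_sum_infsum, rule summable_on_subset[of _ UNIV])
    show "(\<lambda>n. real n ^ k * norm q ^ n) summable_on UNIV"
      by (intro summable_nonneg_imp_summable_on summable_power_geometric) (use q in auto)
  qed auto
  show "((\<lambda>b. case (a, b) of (a, b) \<Rightarrow> (real a * real b) ^ k * norm q ^ (a + b)) has_sum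
          ((real a ^ k * norm q ^ a) * s)) {1..}" for a
    using has_sum_cmult_right[OF S, of "real a ^ k * norm q ^ a"]
    by (simp add: power_add power_mult_distrib mult_ac)
  show "(\<lambda>a. (real a ^ k * norm q ^ a) * s) summable_on {1..}"
    using S by (intro summable_on_cmult_left) (auto simp: summable_on_def)
qed auto

text \<open>The factor \<open>g\<close> is kept general because, besides products of two Lambert
  terms, it will be \<open>u_(a+b)\<close>, \<open>u_(a+b) u_a\<close>, \<open>u_(a+b) u_b\<close>
  and \<open>q^(a b)\<close>.\<close>

lemma summable_pairs:
  assumes w: "poly_bounded w" and C: "C \<ge> 0"
    and g: "\<And>a b. a \<ge> 1 \<Longrightarrow> b \<ge> 1 \<Longrightarrow> norm (g a b) \<le> C * norm q ^ (a + b)"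
  shows "(\<lambda>(a, b). w (of_nat a) (of_nat b) * g a b) summable_on pos_pairs"
proof -
  obtain D k where D: "D \<ge> 0"
    "\<And>a b. a \<ge> 1 \<Longrightarrow> b \<ge> 1 \<Longrightarrow> norm (w (of_nat a) (of_nat b)) \<le> D * (real a * real b) ^ k"
    using w by (elim poly_boundedE) blast
  show ?thesis
  proof (rule Infinite_Sum.abs_summable_summable, rule Infinite_Sum.abs_summable_on_comparison_test')
    show "(\<lambda>x. (D * C) * (case x of (a, b) \<Rightarrow> (real a * real b) ^ k * norm q ^ (a + b)))
            summable_on pos_pairs"
      by (intro summable_on_cmult_right summable_pairs_majorant)
    show "norm (case x of (a, b) \<Rightarrow> w (of_nat a) (of_nat b) * g a b)
       \<le> (D * C) * (case x of (a, b) \<Rightarrow> (real a * real b) ^ k * norm q ^ (a + b))"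
      if xP: "x \<in> pos_pairs" for x
    proof -
      obtain a b where x: "x = (a, b)" "a \<ge> 1" "b \<ge> 1"
        using xP by (cases x) (auto simp: pos_pairs_def)
      have "norm (w (of_nat a) (of_nat b)) * norm (g a b)
          \<le> (D * (real a * real b) ^ k) * (C * norm q ^ (a + b))"
        using D x g[of a b] by (intro mult_mono) auto
      then show ?thesis by (simp add: x norm_mult mult_ac)
    qed
  qed
qed

lemma norm_lambert_term_mult_le:
  assumes "a \<ge> 1" "b \<ge> 1"
  shows "norm (lambert_term q a * lambert_term q b) \<le> (1 / (1 - norm q))\<^sup>2 * norm q ^ (a + b)"
proof -
  have "norm (lambert_term q a) * norm (lambert_term q b)
      \<le> (norm q ^ a / (1 - norm q)) * (norm q ^ b / (1 - norm q))"
    using assms q by (intro mult_mono norm_lambert_term_le) auto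
  then show ?thesis by (simp add: norm_mult power_add power2_eq_square)
qed

lemma summable_pair_sum:
  assumes "poly_bounded w"
  shows "(\<lambda>(a, b). w (of_nat a) (of_nat b) * lambert_term q a * lambert_term q b)
           summable_on pos_pairs"
  using summable_pairs[OF assms, of "(1 / (1 - norm q))\<^sup>2" "\<lambda>a b. lambert_term q a * lambert_term q b"]
    norm_lambert_term_mult_le by (simp add: mult.assoc)

lemma has_sum_pair_sum:
  assumes "poly_bounded w"
  shows "((\<lambda>(a, b). w (of_nat a) (of_nat b) * lambert_term q a * lambert_term q b)
           has_sum pair_sum q w) pos_pairs"
  unfolding pair_sum_def by (intro has_sum_infsum summable_pair_sum assms)

lemma pair_sum_add:
  assumes "poly_bounded v" "poly_bounded w"
  shows "pair_sum q (\<lambda>x y. v x y + w x y) = pair_sum q v + pair_sum q w"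
proof -
  have "((\<lambda>(a, b). (v (of_nat a) (of_nat b) + w (of_nat a) (of_nat b))
          * lambert_term q a * lambert_term q b) has_sum (pair_sum q v + pair_sum q w)) pos_pairs"
    using has_sum_add[OF has_sum_pair_sum[OF assms(1)] has_sum_pair_sum[OF assms(2)]]
    by (simp add: case_prod_unfold ring_distribs)
  then show ?thesis unfolding pair_sum_def[of q "\<lambda>x y. v x y + w x y"] by (rule infsumI)
qed

lemma pair_sum_cmult:
  assumes "poly_bounded w"
  shows "pair_sum q (\<lambda>x y. c * w x y) = c * pair_sum q w"
proof -
  have "((\<lambda>(a, b). (c * w (of_nat a) (of_nat b)) * lambert_term q a * lambert_term q b)
          has_sum (c * pair_sum q w)) pos_pairs"
    using has_sum_cmult_right[OF has_sum_pair_sum[OF assms], of c]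
    by (simp add: case_prod_unfold mult_ac)
  then show ?thesis unfolding pair_sum_def[of q "\<lambda>x y. c * w x y"] by (rule infsumI)
qed

lemma pair_sum_monom:
  "pair_sum q (\<lambda>x y. x ^ i * y ^ j) = lambert_sum i q * lambert_sum j q"
proof -
  have "((\<lambda>(a, b). of_nat a ^ i * of_nat b ^ j * lambert_term q a * lambert_term q b)
          has_sum (lambert_sum i q * lambert_sum j q)) ({1..} \<times> {1..})"
  proof (rule has_sum_SigmaI)
    show "((\<lambda>b. case (a, b) of (a, b) \<Rightarrow>
            of_nat a ^ i * of_nat b ^ j * lambert_term q a * lambert_term q b) has_sum
            ((of_nat a ^ i * lambert_term q a) * lambert_sum j q)) {1..}" for a
      using has_sum_cmult_right[OF has_sum_lambert[of j], of "of_nat a ^ i * lambert_term q a"]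
      by (simp add: mult_ac)
    show "((\<lambda>a. (of_nat a ^ i * lambert_term q a) * lambert_sum j q) has_sum
            (lambert_sum i q * lambert_sum j q)) {1..}"
      by (intro has_sum_cmult_left has_sum_lambert)
    show "(\<lambda>(a, b). of_nat a ^ i * of_nat b ^ j * lambert_term q a * lambert_term q b)
            summable_on {1..} \<times> {1..}"
      using summable_pair_sum[OF poly_bounded_mult[OF poly_bounded_power[OF poly_bounded_fst]
          poly_bounded_power[OF poly_bounded_snd]], of i j] by (simp add: pos_pairs_def)
  qed
  then show ?thesis unfolding pair_sum_def pos_pairs_def by (rule infsumI)
qed

text \<open>For \<open>q \<noteq> 0\<close> the reason is that \<open>1 + 1/u_n = q^(-n)\<close> is
  multiplicative in \<open>n\<close>; this is the addition theorem of the hyperbolic cotangent.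
  Clearing denominators covers \<open>q = 0\<close> as well.\<close>

lemma lambert_term_mult:
  assumes "a \<ge> 1" "b \<ge> 1"
  shows "lambert_term q a * lambert_term q b =
    lambert_term q (a + b) * (1 + lambert_term q a + lambert_term q b)"
  using one_minus_power_nonzero[of a] one_minus_power_nonzero[of b]
    one_minus_power_nonzero[of "a + b"] assms
  by (simp add: lambert_term_def power_add divide_simps) (simp add: algebra_simps)

text \<open>
  The addition formula for the Lambert terms replaces a pair \<open>(a, b)\<close> by pairs with
  one entry \<open>a + b\<close>, so it trades the weight \<open>w\<close> on all pairs for the weight
  \<open>w b (a - b) + w (a - b) b\<close> on the pairs with \<open>b < a\<close>.
\<close>

lemma pair_sum_transfer:
  assumes w: "poly_bounded w" and p: "poly_bounded p"
    and wp: "\<And>x y. w y x + w x y = p (x + y) y + p y (x + y)"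
  shows "pair_sum q w =
    (\<Sum>\<^sub>\<infinity>c\<in>{1..}. (\<Sum>y\<in>{1..<c}. w (of_nat c - of_nat y) (of_nat y)) * lambert_term q c)
    + pair_sum q p - (\<Sum>\<^sub>\<infinity>a\<in>{1..}. p (of_nat a) (of_nat a) * (lambert_term q a)\<^sup>2)"
proof -
  define u where "u = lambert_term q"
  define M where "M = 1 / (1 - norm q)"
  have M: "M \<ge> 0" using q by (simp add: M_def)
  have le1: "norm q ^ n \<le> 1" for n using q by (intro power_le_one) auto
  have b0: "norm (u (a + b)) \<le> M * norm q ^ (a + b)" if "a \<ge> 1" "b \<ge> 1" for a b
    using norm_lambert_term_le[of "a + b"] that by (simp add: u_def M_def)
  have b1: "norm (u (a + b) * u a) \<le> M\<^sup>2 * norm q ^ (a + b)" if "a \<ge> 1" "b \<ge> 1" for a b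
  proof -
    have "norm (u (a + b) * u a) \<le> M\<^sup>2 * norm q ^ (a + b) * norm q ^ a"
      using norm_lambert_term_mult_le[of "a + b" a] that by (simp add: u_def M_def power_add mult_ac)
    also have "\<dots> \<le> M\<^sup>2 * norm q ^ (a + b) * 1"
      by (intro mult_left_mono le1) auto
    finally show ?thesis by simp
  qed
  have b2: "norm (u (a + b) * u b) \<le> M\<^sup>2 * norm q ^ (a + b)" if "a \<ge> 1" "b \<ge> 1" for a b
    using b1[of b a] that by (simp add: add.commute)
  define L where "L = {(a, b). 1 \<le> b \<and> b < (a :: nat)}"
  define L' where "L' = {(a, b). 1 \<le> a \<and> a < (b :: nat)}"
  define \<Delta> where "\<Delta> = {(a, b). 1 \<le> a \<and> a = (b :: nat)}"
  define W where "W = (\<lambda>(a, b). w (of_nat a) (of_nat b) * u a * u b)"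
  define Q where "Q = (\<lambda>(a, b). p (of_nat a) (of_nat b) * u a * u b)"

  have s0: "(\<lambda>(a, b). w (of_nat a) (of_nat b) * u (a + b)) summable_on pos_pairs"
    by (rule summable_pairs[OF w M b0])
  have s1: "(\<lambda>(a, b). w (of_nat a) (of_nat b) * (u (a + b) * u a)) summable_on pos_pairs"
    by (rule summable_pairs[OF w _ b1]) auto
  have s2: "(\<lambda>(a, b). w (of_nat a) (of_nat b) * (u (a + b) * u b)) summable_on pos_pairs"
    by (rule summable_pairs[OF w _ b2]) auto
  have sQ: "Q summable_on pos_pairs"
    using summable_pair_sum[OF p] by (simp add: Q_def u_def)

  define K where "K = (\<Sum>\<^sub>\<infinity>(a, b)\<in>pos_pairs. w (of_nat a) (of_nat b) * u (a + b))"
  define I1 where "I1 = (\<Sum>\<^sub>\<infinity>(a, b)\<in>pos_pairs. w (of_nat a) (of_nat b) * (u (a + b) * u a))"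
  define I2 where "I2 = (\<Sum>\<^sub>\<infinity>(a, b)\<in>pos_pairs. w (of_nat a) (of_nat b) * (u (a + b) * u b))"
  have hK: "((\<lambda>(a, b). w (of_nat a) (of_nat b) * u (a + b)) has_sum K) pos_pairs"
    unfolding K_def by (rule has_sum_infsum[OF s0])
  have h1: "((\<lambda>(a, b). w (of_nat a) (of_nat b) * (u (a + b) * u a)) has_sum I1) pos_pairs"
    unfolding I1_def by (rule has_sum_infsum[OF s1])
  have h2: "((\<lambda>(a, b). w (of_nat a) (of_nat b) * (u (a + b) * u b)) has_sum I2) pos_pairs"
    unfolding I2_def by (rule has_sum_infsum[OF s2])

  have "(W has_sum (K + I1 + I2)) pos_pairs"
  proof (rule has_sum_cong[THEN iffD1, rotated])
    show "((\<lambda>x. (case x of (a, b) \<Rightarrow> w (of_nat a) (of_nat b) * u (a + b))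
        + (case x of (a, b) \<Rightarrow> w (of_nat a) (of_nat b) * (u (a + b) * u a))
        + (case x of (a, b) \<Rightarrow> w (of_nat a) (of_nat b) * (u (a + b) * u b))) has_sum (K + I1 + I2))
        pos_pairs"
      by (intro has_sum_add hK h1 h2)
    show "(case x of (a, b) \<Rightarrow> w (of_nat a) (of_nat b) * u (a + b))
        + (case x of (a, b) \<Rightarrow> w (of_nat a) (of_nat b) * (u (a + b) * u a))
        + (case x of (a, b) \<Rightarrow> w (of_nat a) (of_nat b) * (u (a + b) * u b)) = W x"
      if "x \<in> pos_pairs" for x
    proof -
      obtain a b where x: "x = (a, b)" "a \<ge> 1" "b \<ge> 1"
        using \<open>x \<in> pos_pairs\<close> by (cases x) (auto simp: pos_pairs_def)
      show ?thesis
        unfolding x W_def u_def prod.case mult.assoc lambert_term_mult[OF x(2,3)]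
        by (simp add: ring_distribs)
    qed
  qed
  then have X: "pair_sum q w = K + I1 + I2"
    unfolding pair_sum_def W_def u_def[symmetric] by (rule infsumI)

  \<comment> \<open>The part without a second Lambert term is grouped by \<open>c = a + b\<close>,
    which leaves finite inner sums.\<close>
  have "((\<lambda>(c, y). w (of_nat c - of_nat y) (of_nat y) * u c) has_sum K)
          (Sigma {1..} (\<lambda>c. {1..<c}))"
    by (rule has_sum_reindex_bij_witness[of _ "\<lambda>(a, b). (a + b, b)" "\<lambda>(c, y). (c - y, y)",
          THEN iffD2, OF _ _ _ _ _ _ hK])
       (auto simp: pos_pairs_def of_nat_diff)
  then have "((\<lambda>c. (\<Sum>y\<in>{1..<c}. w (of_nat c - of_nat y) (of_nat y)) * u c) has_sum K) {1..}"
    by (rule has_sum_SigmaD) (auto intro!: has_sum_finiteI simp: sum_distrib_right)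
  then have K: "(\<Sum>\<^sub>\<infinity>c\<in>{1..}. (\<Sum>y\<in>{1..<c}. w (of_nat c - of_nat y) (of_nat y)) * u c) = K"
    by (rule infsumI)

  have "((\<lambda>(a, b). w (of_nat b) (of_nat a - of_nat b) * u a * u b) has_sum I1) L"
    by (rule has_sum_reindex_bij_witness[of _ "\<lambda>(a, b). (a + b, a)" "\<lambda>(a, b). (b, a - b)",
          THEN iffD2, OF _ _ _ _ _ _ h1])
       (auto simp: pos_pairs_def of_nat_diff L_def)
  moreover have "((\<lambda>(a, b). w (of_nat a - of_nat b) (of_nat b) * u a * u b) has_sum I2) L"
    by (rule has_sum_reindex_bij_witness[of _ "\<lambda>(a, b). (a + b, b)" "\<lambda>(a, b). (a - b, b)",
          THEN iffD2, OF _ _ _ _ _ _ h2])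
       (auto simp: pos_pairs_def of_nat_diff L_def)
  ultimately have "((\<lambda>x. (case x of (a, b) \<Rightarrow> w (of_nat b) (of_nat a - of_nat b) * u a * u b)
      + (case x of (a, b) \<Rightarrow> w (of_nat a - of_nat b) (of_nat b) * u a * u b)) has_sum (I1 + I2)) L"
    by (rule has_sum_add)
  also have "(\<lambda>x. (case x of (a, b) \<Rightarrow> w (of_nat b) (of_nat a - of_nat b) * u a * u b)
      + (case x of (a, b) \<Rightarrow> w (of_nat a - of_nat b) (of_nat b) * u a * u b))
      = (\<lambda>x. Q x + Q (prod.swap x))"
  proof (rule ext, clarify)
    fix a b :: nat
    \<comment> \<open>In \<open>wp\<close> the variable \<open>y\<close> occurs before
      \<open>x\<close>, so the instantiation is \<open>y = b\<close> and \<open>x = a - b\<close>,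
      whence \<open>x + y = a\<close>.\<close>
    have e: "w (of_nat b) (of_nat a - of_nat b) + w (of_nat a - of_nat b) (of_nat b)
        = p (of_nat a) (of_nat b) + p (of_nat b) (of_nat a)"
      using wp[of "of_nat b" "of_nat a - of_nat b"] by simp
    have "w (of_nat b) (of_nat a - of_nat b) * u a * u b
        + w (of_nat a - of_nat b) (of_nat b) * u a * u b
        = (w (of_nat b) (of_nat a - of_nat b) + w (of_nat a - of_nat b) (of_nat b)) * (u a * u b)"
      by (simp add: distrib_right mult.assoc)
    also have "\<dots> = (p (of_nat a) (of_nat b) + p (of_nat b) (of_nat a)) * (u a * u b)"
      by (simp only: e)
    also have "\<dots> = Q (a, b) + Q (prod.swap (a, b))"
      by (simp add: Q_def ring_distribs mult_ac)
    finally show "w (of_nat b) (of_nat a - of_nat b) * u a * u b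
        + w (of_nat a - of_nat b) (of_nat b) * u a * u b = Q (a, b) + Q (prod.swap (a, b))" .
  qed
  finally have I: "((\<lambda>x. Q x + Q (prod.swap x)) has_sum (I1 + I2)) L" .

  have sub: "L \<subseteq> pos_pairs" "L' \<subseteq> pos_pairs" "\<Delta> \<subseteq> pos_pairs"
    by (auto simp: L_def L'_def \<Delta>_def pos_pairs_def)
  note sL = summable_on_subset[OF sQ sub(1)]
    and sL' = summable_on_subset[OF sQ sub(2)]
    and sD = summable_on_subset[OF sQ sub(3)]
  have swap: "((\<lambda>x. Q (prod.swap x)) has_sum infsum Q L') L"
    by (rule has_sum_reindex_bij_witness[of _ prod.swap prod.swap, THEN iffD2,
          OF _ _ _ _ _ _ has_sum_infsum[OF sL']])
       (auto simp: L_def L'_def)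
  \<comment> \<open>\<open>I1 + I2\<close> is thus the off-diagonal part of
    \<open>pair_sum q p\<close>; the diagonal is what has to be subtracted in the end.\<close>
  have "infsum Q L + infsum Q L' = I1 + I2"
    using has_sum_add[OF has_sum_infsum[OF sL] swap] I by (rule has_sum_unique)
  moreover have "infsum Q pos_pairs = infsum Q L + infsum Q L' + infsum Q \<Delta>"
  proof -
    have "pos_pairs = (L \<union> L') \<union> \<Delta>"
      by (auto simp: pos_pairs_def L_def L'_def \<Delta>_def)
    moreover have "infsum Q ((L \<union> L') \<union> \<Delta>) = infsum Q (L \<union> L') + infsum Q \<Delta>"
      by (intro infsum_Un_disjoint summable_on_union sL sL' sD)
         (auto simp: L_def L'_def \<Delta>_def)
    moreover have "infsum Q (L \<union> L') = infsum Q L + infsum Q L'"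
      by (intro infsum_Un_disjoint sL sL') (auto simp: L_def L'_def)
    ultimately show ?thesis by simp
  qed
  moreover have "infsum Q \<Delta> = (\<Sum>\<^sub>\<infinity>a\<in>{1..}. p (of_nat a) (of_nat a) * (u a)\<^sup>2)"
    by (rule infsum_reindex_bij_witness[of _ "\<lambda>a. (a, a)" fst])
       (auto simp: \<Delta>_def Q_def power2_eq_square)
  moreover have "infsum Q pos_pairs = pair_sum q p"
    unfolding Q_def pair_sum_def u_def ..
  ultimately have "pair_sum q p = I1 + I2 + (\<Sum>\<^sub>\<infinity>a\<in>{1..}. p (of_nat a) (of_nat a) * (u a)\<^sup>2)"
    by simp
  then show ?thesis
    unfolding X K[symmetric] u_def by simp
qed

end

text \<open>This is \<open>q d/dq\<close> of \<open>lambert_sum j\<close>, since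
  \<open>q d/dq\<close> sends \<open>u_n\<close> to \<open>n (u_n + u_n^2)\<close>. The squares are
  the ones that the diagonal in \<open>pair_sum_transfer\<close> produces, and this is how
  derivatives enter the relations.\<close>

definition lambert_deriv :: "nat \<Rightarrow> complex \<Rightarrow> complex" where
  "lambert_deriv j q =
     (\<Sum>\<^sub>\<infinity>n\<in>{1..}. of_nat n ^ Suc j * (lambert_term q n + (lambert_term q n)\<^sup>2))"

section \<open>Power sums and Ramanujan's relations between Lambert sums\<close>

lemma sum_below_eqI:
  fixes f F :: "nat \<Rightarrow> complex"
  assumes "f 0 = 0" "F 0 = 0" "\<And>c. F (Suc c) = F c + f c"
  shows "(\<Sum>y\<in>{1..<c}. f y) = F c"
proof -
  have "(\<Sum>y\<in>{1..<c}. f y) = (\<Sum>y<c. f y)"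
    using assms(1) by (intro sum.mono_neutral_left) (auto simp: not_le)
  also have "\<dots> = F c"
    by (induction c) (simp_all add: assms)
  finally show ?thesis .
qed

lemma sum_powers_below:
  "(\<Sum>y\<in>{1..<c}. of_nat y :: complex) =
     of_nat c ^ 2 / 2 - of_nat c / 2"
  "(\<Sum>y\<in>{1..<c}. of_nat y ^ 2 :: complex) =
     of_nat c ^ 3 / 3 - of_nat c ^ 2 / 2 + of_nat c / 6"
  "(\<Sum>y\<in>{1..<c}. of_nat y ^ 4 :: complex) =
     of_nat c ^ 5 / 5 - of_nat c ^ 4 / 2 + of_nat c ^ 3 / 3 - of_nat c / 30"
  "(\<Sum>y\<in>{1..<c}. of_nat y ^ 5 :: complex) =
     of_nat c ^ 6 / 6 - of_nat c ^ 5 / 2 + 5 * of_nat c ^ 4 / 12 - of_nat c ^ 2 / 12"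
  "(\<Sum>y\<in>{1..<c}. of_nat y ^ 6 :: complex) =
     of_nat c ^ 7 / 7 - of_nat c ^ 6 / 2 + of_nat c ^ 5 / 2 - of_nat c ^ 3 / 6 + of_nat c / 42"
  by (rule sum_below_eqI; simp add: field_simps eval_nat_numeral)+

context
  fixes q :: complex
  assumes q: "norm q < 1"
begin

lemma infsum_lambert_poly:
  assumes "\<And>c. c \<ge> 1 \<Longrightarrow> f c = (\<Sum>j<m. k j * of_nat c ^ j)"
  shows "(\<Sum>\<^sub>\<infinity>c\<in>{1..}. f c * lambert_term q c) = (\<Sum>j<m. k j * lambert_sum j q)"
proof -
  have "((\<lambda>c. \<Sum>j<m. k j * (of_nat c ^ j * lambert_term q c)) has_sum
          (\<Sum>j<m. k j * lambert_sum j q)) {1..}"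
    by (induction m) (auto intro!: has_sum_add has_sum_cmult_right has_sum_lambert[OF q, simplified])
  also have "?this \<longleftrightarrow> ((\<lambda>c. f c * lambert_term q c) has_sum (\<Sum>j<m. k j * lambert_sum j q)) {1..}"
    by (intro has_sum_cong) (use assms in \<open>auto simp: sum_distrib_right mult.assoc\<close>)
  finally show ?thesis by (rule infsumI)
qed

lemma has_sum_lambert_square:
  "((\<lambda>n. of_nat n ^ Suc j * (lambert_term q n)\<^sup>2) has_sum
     (lambert_deriv j q - lambert_sum (Suc j) q)) {1..}"
  and has_sum_lambert_deriv:
  "((\<lambda>n. of_nat n ^ Suc j * (lambert_term q n + (lambert_term q n)\<^sup>2)) has_sum
     lambert_deriv j q) {1..}"
proof -
  have "(\<lambda>n. of_nat n ^ Suc j * (lambert_term q n)\<^sup>2) summable_on {1..}"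
  proof (rule Infinite_Sum.abs_summable_summable, rule Infinite_Sum.abs_summable_on_comparison_test')
    have "(\<lambda>n. norm (of_nat n ^ Suc j * lambert_term q n)) summable_on {1..}"
      using summable_lambert[OF q] by (subst (asm) summable_on_iff_abs_summable_on_complex)
    then show "(\<lambda>n. norm (of_nat n ^ Suc j * lambert_term q n) * (1 / (1 - norm q))) summable_on {1..}"
      by (rule summable_on_cmult_left)
    fix n :: nat assume n: "n \<in> {1..}"
    have "norm q ^ n \<le> 1" using q by (intro power_le_one) auto
    then have "norm (lambert_term q n) \<le> 1 / (1 - norm q)"
      using norm_lambert_term_le[OF q, of n] n q by (auto elim!: order_trans intro!: divide_right_mono)
    then have "norm (of_nat n ^ Suc j * lambert_term q n) * norm (lambert_term q n)
        \<le> norm (of_nat n ^ Suc j * lambert_term q n) * (1 / (1 - norm q))"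
      by (rule mult_left_mono) auto
    then show "norm (of_nat n ^ Suc j * (lambert_term q n)\<^sup>2)
        \<le> norm (of_nat n ^ Suc j * lambert_term q n) * (1 / (1 - norm q))"
      by (simp only: norm_mult power2_eq_square mult.assoc)
  qed
  then obtain t where t: "((\<lambda>n. of_nat n ^ Suc j * (lambert_term q n)\<^sup>2) has_sum t) {1..}"
    unfolding summable_on_def by blast
  then have D: "((\<lambda>n. of_nat n ^ Suc j * (lambert_term q n + (lambert_term q n)\<^sup>2)) has_sum
      (lambert_sum (Suc j) q + t)) {1..}"
    unfolding distrib_left by (intro has_sum_add has_sum_lambert[OF q])
  then have e: "lambert_deriv j q = lambert_sum (Suc j) q + t"
    unfolding lambert_deriv_def by (rule infsumI)
  show "((\<lambda>n. of_nat n ^ Suc j * (lambert_term q n + (lambert_term q n)\<^sup>2)) has_sum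
     lambert_deriv j q) {1..}"
    using D e by simp
  show "((\<lambda>n. of_nat n ^ Suc j * (lambert_term q n)\<^sup>2) has_sum
     (lambert_deriv j q - lambert_sum (Suc j) q)) {1..}"
    using t e by simp
qed

text \<open>Liouville's identity for the even function \<open>x\<^sup>k\<close>.\<close>

lemma pair_sum_even_power:
  assumes k: "even k"
    and w: "w = (\<lambda>x y :: complex. 2 * y ^ k + (x + y) ^ k)"
    and p: "p = (\<lambda>x y :: complex. 2 * y ^ k + (x - y) ^ k)"
    and S: "\<And>c. c \<ge> 1 \<Longrightarrow> 2 * (\<Sum>y\<in>{1..<c}. of_nat y ^ k) + (of_nat c - 1) * of_nat c ^ k
              = (\<Sum>j<m. s j * of_nat c ^ j :: complex)"
    and k': "k = Suc l"
  shows "pair_sum q (\<lambda>x y. (x + y) ^ k - (x - y) ^ k) =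
    (\<Sum>j<m. s j * lambert_sum j q) - 2 * (lambert_deriv l q - lambert_sum k q)"
proof -
  have pb: "poly_bounded w" "poly_bounded p" "poly_bounded (\<lambda>x y. (x + y) ^ k - (x - y) ^ k)"
    unfolding w p by (intro poly_bounded_add poly_bounded_mult poly_bounded_power
        poly_bounded_const poly_bounded_fst poly_bounded_snd poly_bounded_diff)+
  have minus: "(y - x) ^ k = (x - y) ^ k" for x y :: complex
    using power_minus_even[OF k, of "x - y"] by simp
  have "pair_sum q w =
      (\<Sum>\<^sub>\<infinity>c\<in>{1..}. (\<Sum>y\<in>{1..<c}. w (of_nat c - of_nat y) (of_nat y)) * lambert_term q c)
      + pair_sum q p - (\<Sum>\<^sub>\<infinity>a\<in>{1..}. p (of_nat a) (of_nat a) * (lambert_term q a)\<^sup>2)"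
  proof (rule pair_sum_transfer[OF q pb(1,2)])
    \<comment> \<open>For even \<open>k\<close> both sides equal
      \<open>2 x^k + 2 y^k + 2 (x + y)^k\<close>.\<close>
    show "w y x + w x y = p (x + y) y + p y (x + y)" for x y
      using power_minus_even[OF k, of x] by (simp add: w p add.commute)
  qed
  also have "(\<Sum>\<^sub>\<infinity>c\<in>{1..}. (\<Sum>y\<in>{1..<c}. w (of_nat c - of_nat y) (of_nat y)) * lambert_term q c)
      = (\<Sum>j<m. s j * lambert_sum j q)"
  proof (rule infsum_lambert_poly)
    fix c :: nat assume c: "c \<ge> 1"
    have "(\<Sum>y\<in>{1..<c}. w (of_nat c - of_nat y) (of_nat y))
        = 2 * (\<Sum>y\<in>{1..<c}. of_nat y ^ k) + (of_nat c - 1) * of_nat c ^ k"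
      using c by (simp add: w sum.distrib sum_distrib_left of_nat_diff)
    then show "(\<Sum>y\<in>{1..<c}. w (of_nat c - of_nat y) (of_nat y)) = (\<Sum>j<m. s j * of_nat c ^ j)"
      using S[OF c] by simp
  qed
  also have "(\<Sum>\<^sub>\<infinity>a\<in>{1..}. p (of_nat a) (of_nat a) * (lambert_term q a)\<^sup>2)
      = 2 * (lambert_deriv l q - lambert_sum k q)"
  proof -
    have "(\<Sum>\<^sub>\<infinity>a\<in>{1..}. p (of_nat a) (of_nat a) * (lambert_term q a)\<^sup>2)
        = (\<Sum>\<^sub>\<infinity>a\<in>{1..}. 2 * (of_nat a ^ Suc l * (lambert_term q a)\<^sup>2))"
      by (intro infsum_cong) (simp add: p k')
    then show ?thesis
      unfolding infsum_cmult_right' infsumI[OF has_sum_lambert_square] k' .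
  qed
  also have "pair_sum q w = pair_sum q (\<lambda>x y. (x + y) ^ k - (x - y) ^ k) + pair_sum q p"
    unfolding pair_sum_add[OF q pb(3,2), symmetric] by (simp add: w p add.commute)
  finally show ?thesis by simp
qed

lemma poly_bounded_monom: "poly_bounded (\<lambda>x y. x ^ i * y ^ j)"
  by (intro poly_bounded_mult poly_bounded_power poly_bounded_fst poly_bounded_snd)

lemma pair_sum_cmonom:
  "pair_sum q (\<lambda>x y. c * (x ^ i * y ^ j)) = c * (lambert_sum i q * lambert_sum j q)"
  by (simp add: pair_sum_cmult[OF q poly_bounded_monom] pair_sum_monom[OF q])

text \<open>With \<open>E_2 = 1 - 24 S_1\<close> and \<open>E_4 = 1 + 240 S_3\<close> this is
  Ramanujan's \<open>D E_2 = (E_2^2 - E_4)/12\<close>; it comes from the case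
  \<open>k = 2\<close>.\<close>

lemma lambert_sum_1_square:
  "12 * (lambert_sum 1 q)\<^sup>2 = 5 * lambert_sum 3 q + lambert_sum 1 q - 6 * lambert_deriv 1 q"
proof -
  \<comment> \<open>The list holds the coefficients of the polynomial in \<open>c\<close>. Its entry
    \<open>-2\<close> at index 2 cancels against the diagonal, so that only sums of odd index
    remain.\<close>
  have "2 * (\<Sum>y\<in>{1..<c}. of_nat y ^ 2) + (of_nat c - 1) * of_nat c ^ 2
      = (\<Sum>j<4. [0, 1/3, -2, 5/3] ! j * of_nat c ^ j :: complex)" for c
    unfolding sum_powers_below by (simp add: eval_nat_numeral field_simps)
  then have "pair_sum q (\<lambda>x y. (x + y) ^ 2 - (x - y) ^ 2) =
      (\<Sum>j<4. [0, 1/3, -2, 5/3] ! j * lambert_sum j q) - 2 * (lambert_deriv 1 q - lambert_sum 2 q)"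
    by (intro pair_sum_even_power[OF _ refl refl]) simp_all
  also have "(\<lambda>x y :: complex. (x + y) ^ 2 - (x - y) ^ 2) = (\<lambda>x y. 4 * (x ^ 1 * y ^ 1))"
    by (intro ext) (simp add: power2_eq_square algebra_simps)
  finally show ?thesis
    unfolding pair_sum_cmonom by (simp add: eval_nat_numeral field_simps)
qed

text \<open>With \<open>E_6 = 1 - 504 S_5\<close> this is \<open>D E_4 = (E_2 E_4 - E_6)/3\<close>;
  it comes from the case \<open>k = 4\<close>.\<close>

lemma lambert_sum_1_3:
  "240 * lambert_sum 1 q * lambert_sum 3 q =
     21 * lambert_sum 5 q + 10 * lambert_sum 3 q - lambert_sum 1 q - 30 * lambert_deriv 3 q"
proof -
  have pb: "poly_bounded (\<lambda>x y. 8 * (x ^ i * y ^ j))" for i j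
    by (intro poly_bounded_mult poly_bounded_const poly_bounded_monom)
  have "2 * (\<Sum>y\<in>{1..<c}. of_nat y ^ 4) + (of_nat c - 1) * of_nat c ^ 4
      = (\<Sum>j<6. [0, -1/15, 0, 2/3, -2, 7/5] ! j * of_nat c ^ j :: complex)" for c
    unfolding sum_powers_below by (simp add: eval_nat_numeral field_simps)
  then have "pair_sum q (\<lambda>x y. (x + y) ^ 4 - (x - y) ^ 4) =
      (\<Sum>j<6. [0, -1/15, 0, 2/3, -2, 7/5] ! j * lambert_sum j q)
        - 2 * (lambert_deriv 3 q - lambert_sum 4 q)"
    by (intro pair_sum_even_power[OF _ refl refl]) simp_all
  also have "(\<lambda>x y :: complex. (x + y) ^ 4 - (x - y) ^ 4)
      = (\<lambda>x y. 8 * (x ^ 1 * y ^ 3) + 8 * (x ^ 3 * y ^ 1))"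
    by (intro ext) (simp add: eval_nat_numeral algebra_simps)
  finally show ?thesis
    unfolding pair_sum_add[OF q pb pb] pair_sum_cmonom by (simp add: eval_nat_numeral field_simps)
qed

text \<open>In the case \<open>k = 6\<close> the monomial \<open>x^3 y^3\<close> brings in the
  square of \<open>S_3\<close>, and the power sum brings in \<open>S_7\<close>. Eliminating
  \<open>S_7\<close> by \<open>lambert_sum_3_square\<close> turns this into
  \<open>D E_6 = (E_2 E_6 - E_4^2)/2\<close>.\<close>

lemma lambert_sum_1_5:
  "504 * lambert_sum 1 q * lambert_sum 5 q + 840 * (lambert_sum 3 q)\<^sup>2 =
     27 * lambert_sum 7 q + 21 * lambert_sum 5 q - 7 * lambert_sum 3 q + lambert_sum 1 q
     - 42 * lambert_deriv 5 q"
proof -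
  have pb: "poly_bounded (\<lambda>x y. c * (x ^ i * y ^ j))" for c i j
    by (intro poly_bounded_mult poly_bounded_const poly_bounded_monom)
  have "2 * (\<Sum>y\<in>{1..<c}. of_nat y ^ 6) + (of_nat c - 1) * of_nat c ^ 6
      = (\<Sum>j<8. [0, 1/21, 0, -1/3, 0, 1, -2, 9/7] ! j * of_nat c ^ j :: complex)" for c
    unfolding sum_powers_below by (simp add: eval_nat_numeral field_simps)
  then have "pair_sum q (\<lambda>x y. (x + y) ^ 6 - (x - y) ^ 6) =
      (\<Sum>j<8. [0, 1/21, 0, -1/3, 0, 1, -2, 9/7] ! j * lambert_sum j q)
        - 2 * (lambert_deriv 5 q - lambert_sum 6 q)"
    by (intro pair_sum_even_power[OF _ refl refl]) simp_all
  also have "(\<lambda>x y :: complex. (x + y) ^ 6 - (x - y) ^ 6)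
      = (\<lambda>x y. 12 * (x ^ 1 * y ^ 5) + (40 * (x ^ 3 * y ^ 3) + 12 * (x ^ 5 * y ^ 1)))"
    by (intro ext) (simp add: eval_nat_numeral algebra_simps)
  finally show ?thesis
    unfolding pair_sum_add[OF q pb poly_bounded_add[OF pb pb]] pair_sum_add[OF q pb pb] pair_sum_cmonom
    by (simp add: eval_nat_numeral field_simps)
qed

text \<open>
  The weights are chosen such that \<open>w - p\<close> has the symmetrisation \<open>12 x\<^sup>3 y\<^sup>3\<close> and \<open>p\<close> vanishes
  on the diagonal; the result amounts to \<open>E\<^sub>8 = E\<^sub>4\<^sup>2\<close>.
\<close>

lemma lambert_sum_3_square:
  "120 * (lambert_sum 3 q)\<^sup>2 = lambert_sum 7 q - lambert_sum 3 q"
proof -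
  define w where "w = (\<lambda>x y :: complex. x * y * (x + y) ^ 4 - 2 * x * (x + y) * y ^ 4)"
  define p where "p = (\<lambda>x y :: complex. 2 * x * y ^ 5 - 2 * x ^ 2 * y ^ 4 - x * y * (x - y) ^ 4)"
  have pb: "poly_bounded (\<lambda>x y. c * (x ^ i * y ^ j))" for c i j
    by (intro poly_bounded_mult poly_bounded_const poly_bounded_monom)
  have pb': "poly_bounded w" "poly_bounded p"
    unfolding w_def p_def
    by (intro poly_bounded_add poly_bounded_mult poly_bounded_power
        poly_bounded_const poly_bounded_fst poly_bounded_snd poly_bounded_diff)+
  have "pair_sum q w =
      (\<Sum>\<^sub>\<infinity>c\<in>{1..}. (\<Sum>y\<in>{1..<c}. w (of_nat c - of_nat y) (of_nat y)) * lambert_term q c)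
      + pair_sum q p - (\<Sum>\<^sub>\<infinity>a\<in>{1..}. p (of_nat a) (of_nat a) * (lambert_term q a)\<^sup>2)"
    by (rule pair_sum_transfer[OF q pb'])
       (simp add: w_def p_def eval_nat_numeral algebra_simps)
  also have "(\<Sum>\<^sub>\<infinity>a\<in>{1..}. p (of_nat a) (of_nat a) * (lambert_term q a)\<^sup>2) = 0"
    by (simp add: p_def eval_nat_numeral)
  also have "(\<Sum>\<^sub>\<infinity>c\<in>{1..}. (\<Sum>y\<in>{1..<c}. w (of_nat c - of_nat y) (of_nat y)) * lambert_term q c)
      = (\<Sum>j<8. [0, 0, 0, -1/10, 0, 0, 0, 1/10] ! j * lambert_sum j q)"
  proof (rule infsum_lambert_poly)
    fix c :: nat
    have "(\<Sum>y\<in>{1..<c}. w (of_nat c - of_nat y) (of_nat y))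
        = (\<Sum>y\<in>{1..<c}. of_nat c ^ 5 * of_nat y - of_nat c ^ 4 * of_nat y ^ 2
             - 2 * of_nat c ^ 2 * of_nat y ^ 4 + 2 * of_nat c * of_nat y ^ 5)"
      by (intro sum.cong) (simp_all add: w_def eval_nat_numeral algebra_simps)
    also have "\<dots> = of_nat c ^ 5 * (\<Sum>y\<in>{1..<c}. of_nat y) - of_nat c ^ 4 * (\<Sum>y\<in>{1..<c}. of_nat y ^ 2)
             - 2 * of_nat c ^ 2 * (\<Sum>y\<in>{1..<c}. of_nat y ^ 4)
             + 2 * of_nat c * (\<Sum>y\<in>{1..<c}. of_nat y ^ 5)"
      by (simp add: sum.distrib sum_subtractf sum_distrib_left)
    also have "\<dots> = (\<Sum>j<8. [0, 0, 0, -1/10, 0, 0, 0, 1/10] ! j * of_nat c ^ j)"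
      unfolding sum_powers_below by (simp add: eval_nat_numeral field_simps)
    finally show "(\<Sum>y\<in>{1..<c}. w (of_nat c - of_nat y) (of_nat y))
        = (\<Sum>j<8. [0, 0, 0, -1/10, 0, 0, 0, 1/10] ! j * of_nat c ^ j)" .
  qed
  \<comment> \<open>This is \<open>w - p\<close> expanded. The monomials \<open>2 x^5 y\<close> and
    \<open>-2 x y^5\<close> give \<open>S_5 S_1\<close> with opposite signs and cancel.\<close>
  also have "pair_sum q w = pair_sum q (\<lambda>x y. 2 * (x ^ 5 * y ^ 1) + (12 * (x ^ 3 * y ^ 3)
      + ((-2) * (x ^ 1 * y ^ 5)))) + pair_sum q p"
    unfolding pair_sum_add[OF q poly_bounded_add[OF pb poly_bounded_add[OF pb pb]] pb'(2), symmetric]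
    by (rule arg_cong[of _ _ "pair_sum q"], intro ext)
       (simp add: w_def p_def eval_nat_numeral algebra_simps)
  finally show ?thesis
    unfolding pair_sum_add[OF q pb poly_bounded_add[OF pb pb]] pair_sum_add[OF q pb pb] pair_sum_cmonom
    by (simp add: eval_nat_numeral field_simps)
qed

end

subsection \<open>The pentagonal number theorem\<close>

definition euler_function :: "complex \<Rightarrow> complex" where
  "euler_function q = (\<Prod>n. 1 - q ^ Suc n)"

text \<open>
  Shanks's finite form of the pentagonal number theorem: the sums over \<open>s < n\<close> telescope in \<open>n\<close>
  to partial sums of the pentagonal series, and only the summand \<open>s = 0\<close>, a partial product,
  survives as \<open>n\<close> tends to infinity.
\<close>

definition shanks_term :: "complex \<Rightarrow> nat \<Rightarrow> nat \<Rightarrow> complex" where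
  "shanks_term q n s =
     (-1) ^ s * (\<Prod>i\<in>{s..<n}. 1 - q ^ Suc i) * q ^ (s * n + s * (s + 1) div 2)"

lemma triangle_Suc: "Suc s * (Suc s + 1) div 2 = s * (s + 1) div 2 + Suc s"
proof -
  have "Suc s * (Suc s + 1) = s * (s + 1) + Suc s * 2" by simp
  then show ?thesis by (simp only: div_mult_self1)
qed

lemma pentagonal_triangle: "(n :: nat) * (3 * n + 1) div 2 = n * n + n * (n + 1) div 2"
proof -
  have "n * (3 * n + 1) = n * (n + 1) + n * n * 2" by (simp add: algebra_simps)
  then show ?thesis by (simp only: div_mult_self1)
qed

text \<open>For fixed \<open>n\<close> the differences telescope in \<open>s\<close>: the one at
  \<open>Suc j\<close> is the change of the right-hand side from \<open>j\<close> to
  \<open>Suc j\<close>. The bound on \<open>j\<close> allows the first factor of the product over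
  \<open>{j..<n}\<close> to be split off.\<close>

lemma sum_shanks_term_diff:
  assumes "Suc j \<le> n"
  shows "(\<Sum>s<Suc j. shanks_term q (Suc n) s - shanks_term q n s)
    = - (shanks_term q n j * q ^ (Suc n + j))"
  using assms
proof (induction j)
  case 0
  have "(\<Prod>i\<in>{0..<Suc n}. 1 - q ^ Suc i) = (\<Prod>i\<in>{0..<n}. 1 - q ^ Suc i) * (1 - q ^ Suc n)"
    by simp
  then show ?case by (simp add: shanks_term_def algebra_simps)
next
  case (Suc j)
  define R where "R = (\<Prod>i\<in>{Suc j..<n}. 1 - q ^ Suc i)"
  define X where "X = q ^ (j * n + j * (j + 1) div 2)"
  have R1: "(\<Prod>i\<in>{j..<n}. 1 - q ^ Suc i) = (1 - q ^ Suc j) * R"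
    using Suc.prems by (simp add: R_def prod.atLeast_Suc_lessThan)
  have R2: "(\<Prod>i\<in>{Suc j..<Suc n}. 1 - q ^ Suc i) = R * (1 - q ^ Suc n)"
    using Suc.prems by (simp add: R_def)
  have e1: "q ^ (Suc j * n + Suc j * (Suc j + 1) div 2) = X * q ^ n * q ^ Suc j"
    unfolding triangle_Suc X_def by (simp add: power_add[symmetric] algebra_simps)
  have e2: "q ^ (Suc j * Suc n + Suc j * (Suc j + 1) div 2) = X * q ^ n * q ^ Suc j * q ^ Suc j"
    unfolding triangle_Suc X_def by (simp only: power_add[symmetric]) (simp add: algebra_simps)
  have t0: "shanks_term q n j = (-1) ^ j * ((1 - q ^ Suc j) * R) * X"
    unfolding shanks_term_def R1 X_def ..
  have t1: "shanks_term q n (Suc j) = - ((-1) ^ j) * R * (X * q ^ n * q ^ Suc j)"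
    unfolding shanks_term_def e1 R_def by simp
  have t2: "shanks_term q (Suc n) (Suc j)
      = - ((-1) ^ j) * (R * (1 - q ^ Suc n)) * (X * q ^ n * q ^ Suc j * q ^ Suc j)"
    unfolding shanks_term_def e2 R2 by simp
  have "(\<Sum>s<Suc (Suc j). shanks_term q (Suc n) s - shanks_term q n s)
      = - (shanks_term q n j * q ^ (Suc n + j)) + (shanks_term q (Suc n) (Suc j) - shanks_term q n (Suc j))"
    using Suc by simp
  also have "\<dots> = - (shanks_term q n (Suc j) * q ^ (Suc n + Suc j))"
    unfolding t0 t1 t2 power_add power_Suc by (simp add: algebra_simps)
  finally show ?case .
qed

text \<open>Passing from \<open>n\<close> to \<open>n + 1\<close> adds the telescoped differences,
  with \<open>j = n - 1\<close>, and the new summand \<open>s = n\<close>. With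
  \<open>X = q^(n (3 n + 1)/2)\<close> and up to the sign \<open>(-1)^n\<close> they are
  \<open>X (1 - q^n)\<close> and \<open>X q^n (1 - q^(n+1))\<close>, which add up to
  \<open>X (1 - q^(2 n + 1))\<close>.\<close>

lemma sum_shanks_term:
  "(\<Sum>s<n. shanks_term q n s) =
   (\<Sum>m<n. (-1) ^ m * q ^ (m * (3 * m + 1) div 2) * (1 - q ^ (2 * m + 1)))"
proof (induction n)
  case (Suc n)
  have "(\<Sum>s<Suc n. shanks_term q (Suc n) s)
      = (\<Sum>s<n. shanks_term q n s) + ((\<Sum>s<n. shanks_term q (Suc n) s - shanks_term q n s)
          + shanks_term q (Suc n) n)"
    by (simp add: sum_subtractf)
  also have "(\<Sum>s<n. shanks_term q (Suc n) s - shanks_term q n s) + shanks_term q (Suc n) n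
      = (-1) ^ n * q ^ (n * (3 * n + 1) div 2) * (1 - q ^ (2 * n + 1))"
  proof (cases n)
    case 0
    then show ?thesis by (simp add: shanks_term_def)
  next
    case (Suc j)
    define X where "X = q ^ (n * n + n * (n + 1) div 2)"
    have "j * n + j * (j + 1) div 2 + (Suc n + j) = n * n + n * (n + 1) div 2"
      unfolding Suc triangle_Suc by (simp add: algebra_simps)
    then have e: "q ^ (j * n + j * (j + 1) div 2) * q ^ (Suc n + j) = X"
      by (simp only: X_def power_add[symmetric])
    have "{j..<n} = {j}" using Suc by auto
    then have "shanks_term q n j * q ^ (Suc n + j)
        = (-1) ^ j * (1 - q ^ n) * (q ^ (j * n + j * (j + 1) div 2) * q ^ (Suc n + j))"
      unfolding shanks_term_def Suc by (simp only: prod.insert) simp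
    then have t1: "(\<Sum>s<n. shanks_term q (Suc n) s - shanks_term q n s) = (-1) ^ n * (1 - q ^ n) * X"
      using sum_shanks_term_diff[of j n q] Suc unfolding e by simp
    have "{n..<Suc n} = {n}" by auto
    then have t2: "shanks_term q (Suc n) n = (-1) ^ n * (1 - q ^ Suc n) * (X * q ^ n)"
      unfolding shanks_term_def X_def by (simp add: power_add[symmetric] algebra_simps)
    have "q ^ (2 * n + 1) = q ^ n * q ^ n * q"
      by (simp add: power_add mult_2)
    then show ?thesis
      unfolding t1 t2 pentagonal_triangle X_def[symmetric] by (simp add: algebra_simps)
  qed
  finally show ?case using Suc by simp
qed simp

context
  fixes q :: complex
  assumes q: "norm q < 1"
begin

lemma convergent_prod_euler: "convergent_prod (\<lambda>n. 1 - q ^ Suc n)"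
proof (rule abs_convergent_prod_imp_convergent_prod, rule summable_imp_abs_convergent_prod)
  have "summable (\<lambda>n. norm q * norm q ^ n)"
    using q by (intro summable_mult summable_geometric) auto
  then show "summable (\<lambda>i. norm (1 - q ^ Suc i - 1))"
    by (simp add: norm_mult norm_power)
qed

lemma euler_function_nonzero: "euler_function q \<noteq> 0"
  unfolding euler_function_def
  using one_minus_power_nonzero[OF q, of "Suc _"]
  by (intro prodinf_nonzero convergent_prod_euler) auto

lemma euler_function_tendsto: "(\<lambda>n. \<Prod>i<n. 1 - q ^ Suc i) \<longlonglongrightarrow> euler_function q"
  using has_prod_imp_tendsto'[OF convergent_prod_has_prod[OF convergent_prod_euler]]
  unfolding euler_function_def .

theorem pentagonal_number:
  "(\<lambda>m. (-1) ^ m * q ^ (m * (3 * m + 1) div 2) * (1 - q ^ (2 * m + 1))) sums euler_function q"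
proof -
  define r where "r = norm q"
  have r: "0 \<le> r" "r < 1" using q by (auto simp: r_def)
  \<comment> \<open>A bound for all partial products at once: each factor has norm at most
    \<open>1 + r^i\<close>, hence at most \<open>exp (r^i)\<close>, and the geometric series bounds
    the exponents.\<close>
  define C where "C = exp (1 / (1 - r))"
  have C: "C \<ge> 0" by (simp add: C_def)
  have prod_le: "norm (\<Prod>i\<in>{s..<n}. 1 - q ^ Suc i) \<le> C" for s n
  proof -
    have "norm (\<Prod>i\<in>{s..<n}. 1 - q ^ Suc i) = (\<Prod>i\<in>{s..<n}. norm (1 - q ^ Suc i))"
      by (simp add: prod_norm)
    also have "\<dots> \<le> (\<Prod>i\<in>{s..<n}. exp (r ^ i))"
    proof (intro prod_mono conjI)
      fix i
      have "norm (1 - q ^ Suc i) \<le> 1 + r ^ Suc i"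
        using norm_triangle_ineq4[of 1 "q ^ Suc i"] by (simp add: r_def norm_power norm_mult)
      also have "\<dots> \<le> 1 + r ^ i" using r by (simp add: mult_left_le_one_le)
      also have "\<dots> \<le> exp (r ^ i)" by (rule exp_ge_add_one_self)
      finally show "norm (1 - q ^ Suc i) \<le> exp (r ^ i)" .
    qed auto
    also have "\<dots> = exp (\<Sum>i\<in>{s..<n}. r ^ i)" by (simp add: exp_sum)
    also have "\<dots> \<le> C"
      unfolding C_def exp_le_cancel_iff using r suminf_geometric[of r]
      by (metis abs_of_nonneg finite_atLeastLessThan real_norm_def sum_le_suminf summable_geometric
          zero_le_power)
    finally show ?thesis .
  qed
  \<comment> \<open>For \<open>s \<ge> 1\<close> the exponent is at least \<open>n\<close>, so the
    fewer than \<open>n\<close> summands other than \<open>s = 0\<close> contribute at most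
    \<open>n C r^n\<close>, which tends to 0.\<close>
  have term_le: "norm (shanks_term q n s) \<le> C * r ^ n" if "s \<ge> 1" for n s
  proof -
    have "n \<le> s * n + s * (s + 1) div 2" using that by (simp add: trans_le_add1)
    then have "norm (q ^ (s * n + s * (s + 1) div 2)) \<le> r ^ n"
      unfolding norm_power r_def[symmetric] using r by (intro power_decreasing) auto
    then have "norm (\<Prod>i\<in>{s..<n}. 1 - q ^ Suc i) * norm (q ^ (s * n + s * (s + 1) div 2)) \<le> C * r ^ n"
      by (intro mult_mono prod_le C) auto
    then show ?thesis by (simp add: shanks_term_def norm_mult norm_power)
  qed
  have "(\<lambda>n. (\<Prod>i<n. 1 - q ^ Suc i) + (\<Sum>s\<in>{1..<n}. shanks_term q n s)) \<longlonglongrightarrow> euler_function q + 0"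
  proof (rule tendsto_add[OF euler_function_tendsto], rule Lim_null_comparison)
    show "\<forall>\<^sub>F n in sequentially. norm (\<Sum>s\<in>{1..<n}. shanks_term q n s) \<le> C * (real n ^ 1 * r ^ n)"
    proof (rule always_eventually, rule allI)
      fix n
      have "norm (\<Sum>s\<in>{1..<n}. shanks_term q n s) \<le> real (card {1..<n}) * (C * r ^ n)"
        by (rule sum_norm_bound[of _ _ "C * r ^ n", unfolded]) (use term_le in auto)
      also have "\<dots> \<le> real n * (C * r ^ n)"
        using r C by (intro mult_right_mono) auto
      finally show "norm (\<Sum>s\<in>{1..<n}. shanks_term q n s) \<le> C * (real n ^ 1 * r ^ n)"
        by (simp add: mult_ac)
    qed
    show "(\<lambda>n. C * (real n ^ 1 * r ^ n)) \<longlonglongrightarrow> 0"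
      using tendsto_mult_right_zero[OF summable_LIMSEQ_zero[OF summable_power_geometric[OF r]]] .
  qed
  then have lim: "(\<lambda>n. (\<Prod>i<n. 1 - q ^ Suc i) + (\<Sum>s\<in>{1..<n}. shanks_term q n s))
      \<longlonglongrightarrow> euler_function q"
    by simp
  have "(\<lambda>n. \<Sum>s<n. shanks_term q n s) \<longlonglongrightarrow> euler_function q"
  proof (rule Lim_transform_eventually[OF lim])
    show "\<forall>\<^sub>F n in sequentially. (\<Prod>i<n. 1 - q ^ Suc i) + (\<Sum>s\<in>{1..<n}. shanks_term q n s)
        = (\<Sum>s<n. shanks_term q n s)"
    proof (rule eventually_sequentiallyI[of 1])
      fix n :: nat assume "n \<ge> 1"
      then have "{..<n} = insert 0 {1..<n}" by auto
      then have "(\<Sum>s<n. shanks_term q n s) = shanks_term q n 0 + (\<Sum>s\<in>{1..<n}. shanks_term q n s)"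
        by simp
      then show "(\<Prod>i<n. 1 - q ^ Suc i) + (\<Sum>s\<in>{1..<n}. shanks_term q n s)
        = (\<Sum>s<n. shanks_term q n s)"
        by (simp add: shanks_term_def atLeast0LessThan)
    qed
  qed
  then show ?thesis unfolding sum_shanks_term sums_def .
qed

end

lemma has_sum_imp_sums_Suc:
  assumes "(f has_sum s) {1 :: nat..}"
  shows "(\<lambda>n. f (Suc n)) sums s"
proof -
  have "((\<lambda>n. f (Suc n)) has_sum s) UNIV"
    by (rule has_sum_reindex_bij_witness[of _ "\<lambda>n. n - 1" Suc, THEN iffD2, OF _ _ _ _ _ _ assms])
       auto
  then show ?thesis by (rule has_sum_imp_sums)
qed

section \<open>The logarithmic derivative of the Euler product\<close>

lemma uniform_limit_euler:
  assumes "0 < \<rho>" "\<rho> < 1"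
  shows "uniform_limit (ball 0 \<rho>) (\<lambda>n q. \<Prod>k<n. 1 - q ^ Suc k) euler_function sequentially"
proof -
  have "uniformly_convergent_on (cball 0 \<rho>) (\<lambda>N q :: complex. \<Prod>n<N. 1 - q ^ Suc n)"
  proof (rule uniformly_convergent_on_prod')
    show "uniformly_convergent_on (cball 0 \<rho>) (\<lambda>N q :: complex. \<Sum>n<N. norm (1 - q ^ Suc n - 1))"
    proof (rule Weierstrass_m_test')
      show "norm (norm (1 - q ^ Suc n - 1)) \<le> \<rho> ^ Suc n" if "q \<in> cball 0 \<rho>" for n and q :: complex
        using that power_mono[of "norm q" \<rho> "Suc n"] by (simp add: norm_power norm_mult)
      show "summable (\<lambda>n. \<rho> ^ Suc n)"
        using assms by (simp add: summable_mult)
    qed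
  qed (auto intro!: continuous_intros)
  then obtain l where l: "uniform_limit (cball 0 \<rho>) (\<lambda>n q :: complex. \<Prod>k<n. 1 - q ^ Suc k) l sequentially"
    unfolding uniformly_convergent_on_def by blast
  have "l q = euler_function q" if "q \<in> ball 0 \<rho>" for q
  proof (rule LIMSEQ_unique)
    show "(\<lambda>n. \<Prod>k<n. 1 - q ^ Suc k) \<longlonglongrightarrow> l q"
      using that by (intro tendsto_uniform_limitI[OF l]) auto
    show "(\<lambda>n. \<Prod>k<n. 1 - q ^ Suc k) \<longlonglongrightarrow> euler_function q"
      using that assms by (intro euler_function_tendsto) auto
  qed
  moreover have "uniform_limit (ball 0 \<rho>) (\<lambda>n q. \<Prod>k<n. 1 - q ^ Suc k) l sequentially"
    by (rule uniform_limit_on_subset[OF l]) auto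
  ultimately show ?thesis
    by (subst uniform_limit_cong'[where g = "\<lambda>n q. \<Prod>k<n. 1 - q ^ Suc k" and i = l]) auto
qed

text \<open>Locally uniform convergence permits taking the logarithmic derivative factor by factor;
  \<open>1 - q^n\<close> contributes \<open>- n u_n / q\<close>.\<close>

lemma has_field_derivative_euler:
  assumes q: "norm q < 1" "q \<noteq> 0"
  shows "(euler_function has_field_derivative (- lambert_sum 1 q * euler_function q / q)) (at q)"
proof -
  obtain \<rho> where \<rho>: "norm q < \<rho>" "\<rho> < 1" using q dense by blast
  have "0 < \<rho>" using \<rho> norm_ge_zero[of q] by linarith
  note lim = uniform_limit_euler[OF this \<rho>(2)]
  have mem: "q \<in> ball 0 \<rho>" using \<rho> by simp
  have holo: "euler_function holomorphic_on ball 0 \<rho>"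
  proof (rule holomorphic_uniform_sequence[OF open_ball])
    fix x :: complex assume "x \<in> ball 0 \<rho>"
    then obtain d where "d > 0" "cball x d \<subseteq> ball 0 \<rho>"
      using open_contains_cball open_ball by blast
    then show "\<exists>d>0. cball x d \<subseteq> ball 0 \<rho> \<and>
        uniform_limit (cball x d) (\<lambda>n q. \<Prod>k<n. 1 - q ^ Suc k) euler_function sequentially"
      using uniform_limit_on_subset[OF lim] by blast
  qed (auto intro!: holomorphic_intros)
  have "(\<lambda>k. deriv (\<lambda>q. 1 - q ^ Suc k) q / (1 - q ^ Suc k)) sums
      (deriv euler_function q / euler_function q)"
    by (rule logderiv_prodinf_complex_uniform_limit[OF lim _ euler_function_nonzero[OF q(1)] _ mem])
       (auto intro!: holomorphic_intros)
  also have "(\<lambda>k. deriv (\<lambda>q. 1 - q ^ Suc k) q / (1 - q ^ Suc k))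
      = (\<lambda>k. - (of_nat (Suc k) ^ 1 * lambert_term q (Suc k)) / q)"
  proof
    fix k
    have "deriv (\<lambda>q. 1 - q ^ Suc k) q = - (of_nat (Suc k) * q ^ k)"
      by (intro DERIV_imp_deriv) (auto intro!: derivative_eq_intros simp del: power_Suc)
    then show "deriv (\<lambda>q. 1 - q ^ Suc k) q / (1 - q ^ Suc k)
      = - (of_nat (Suc k) ^ 1 * lambert_term q (Suc k)) / q"
      using q by (simp add: lambert_term_def)
  qed
  finally have 1: "(\<lambda>k. - (of_nat (Suc k) ^ 1 * lambert_term q (Suc k)) / q) sums
      (deriv euler_function q / euler_function q)" .
  have "(\<lambda>k. - (of_nat (Suc k) ^ 1 * lambert_term q (Suc k)) / q) sums (- lambert_sum 1 q / q)"
    by (intro sums_divide sums_minus has_sum_imp_sums_Suc has_sum_lambert[OF q(1)])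
  with 1 have "deriv euler_function q / euler_function q = - lambert_sum 1 q / q"
    by (rule sums_unique2)
  then have "deriv euler_function q = - lambert_sum 1 q * euler_function q / q"
    using euler_function_nonzero[OF q(1)] by (simp add: field_simps)
  then show ?thesis
    using holomorphic_derivI[OF holo open_ball mem] by simp
qed

subsection \<open>Derivatives of Eisenstein series and of the eta function\<close>

lemma has_field_derivative_lambert_term:
  assumes "norm q < 1" "n \<ge> 1" "q \<noteq> 0"
  shows "((\<lambda>q. of_nat n ^ j * lambert_term q n) has_field_derivative
    of_nat n ^ Suc j * (lambert_term q n + (lambert_term q n)\<^sup>2) / q) (at q)"
proof -
  have nz: "1 - q ^ n \<noteq> 0"
    by (rule one_minus_power_nonzero[OF assms(1,2)])
  have e: "q ^ n = q ^ (n - 1) * q"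
    using assms(2) by (cases n) auto
  have "((\<lambda>q. of_nat n ^ j * lambert_term q n) has_field_derivative
     of_nat n ^ j * ((of_nat n * q ^ (n - 1) * (1 - q ^ n) + q ^ n * (of_nat n * q ^ (n - 1)))
       / (1 - q ^ n)\<^sup>2)) (at q)"
    unfolding lambert_term_def using nz
    by (auto intro!: derivative_eq_intros simp: power2_eq_square algebra_simps)
  also have "of_nat n ^ j * ((of_nat n * q ^ (n - 1) * (1 - q ^ n) + q ^ n * (of_nat n * q ^ (n - 1)))
       / (1 - q ^ n)\<^sup>2) = of_nat n ^ Suc j * (q ^ n / (1 - q ^ n)\<^sup>2) / q"
    using assms(3) unfolding e by (simp add: field_simps)
  also have "q ^ n / (1 - q ^ n)\<^sup>2 = lambert_term q n + (lambert_term q n)\<^sup>2"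
    using nz unfolding lambert_term_def by (simp add: divide_simps power2_eq_square) (simp add: algebra_simps)
  finally show ?thesis .
qed

lemma has_field_derivative_lambert_sum:
  assumes q: "norm q < 1" "q \<noteq> 0"
  shows "(lambert_sum j has_field_derivative lambert_deriv j q / q) (at q)"
proof -
  \<comment> \<open>The disc is punctured because the derivatives are written with a division by the
    variable.\<close>
  define S where "S = ball 0 1 - {0 :: complex}"
  have "\<exists>g g'. \<forall>x\<in>S. (\<lambda>n. of_nat (Suc n) ^ j * lambert_term x (Suc n)) sums g x \<and>
      (\<lambda>n. of_nat (Suc n) ^ Suc j * (lambert_term x (Suc n) + (lambert_term x (Suc n))\<^sup>2) / x) sums g' x \<and>
      (g has_field_derivative g' x) (at x)"
  proof (rule series_and_derivative_comparison_local)
    show "open S" by (auto simp: S_def intro!: open_Diff)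
    show "((\<lambda>x. of_nat (Suc n) ^ j * lambert_term x (Suc n)) has_field_derivative
        of_nat (Suc n) ^ Suc j * (lambert_term x (Suc n) + (lambert_term x (Suc n))\<^sup>2) / x) (at x)"
      if "x \<in> S" for n x
      using that by (intro has_field_derivative_lambert_term) (auto simp: S_def)
    fix x assume "x \<in> S"
    then obtain \<rho> where \<rho>: "norm x < \<rho>" "\<rho> < 1"
      using dense[of "norm x" 1] by (auto simp: S_def)
    then have "\<rho> > 0" using norm_ge_zero[of x] by linarith
    define h where "h = (\<lambda>n. real (Suc n) ^ j * \<rho> ^ Suc n / (1 - \<rho>))"
    have "summable (\<lambda>n. real n ^ j * \<rho> ^ n / (1 - \<rho>))"
      using \<rho> \<open>\<rho> > 0\<close> by (intro summable_divide summable_power_geometric) auto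
    then have "summable h"
      unfolding h_def by (subst summable_Suc_iff)
    moreover have "norm (of_nat (Suc n) ^ j * lambert_term y (Suc n)) \<le> h n"
      if "y \<in> ball x (\<rho> - norm x)" for n y
    proof -
      have y: "norm y < \<rho>"
        using that norm_triangle_ineq2[of y x] by (simp add: dist_norm norm_minus_commute)
      have "norm (lambert_term y (Suc n)) \<le> norm y ^ Suc n / (1 - norm y)"
        using y \<rho> by (intro norm_lambert_term_le) auto
      also have "\<dots> \<le> \<rho> ^ Suc n / (1 - \<rho>)"
        using y \<rho> \<open>\<rho> > 0\<close> by (intro frac_le power_mono) auto
      finally have "norm (of_nat (Suc n) ^ j :: complex) * norm (lambert_term y (Suc n))
          \<le> real (Suc n) ^ j * (\<rho> ^ Suc n / (1 - \<rho>))"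
        by (intro mult_mono) (simp_all only: norm_power norm_of_nat, auto)
      then show ?thesis by (simp only: h_def norm_mult times_divide_eq_right)
    qed
    ultimately show "\<exists>d h. 0 < d \<and> summable h \<and> (\<forall>\<^sub>F n in sequentially. \<forall>y\<in>ball x d \<inter> S.
        norm (of_nat (Suc n) ^ j * lambert_term y (Suc n)) \<le> h n)"
      using \<rho>(1) by (intro exI[of _ "\<rho> - norm x"] exI[of _ h]) auto
  qed
  then obtain g g' where g: "\<And>x. x \<in> S \<Longrightarrow> (\<lambda>n. of_nat (Suc n) ^ j * lambert_term x (Suc n)) sums g x"
    "\<And>x. x \<in> S \<Longrightarrow> (\<lambda>n. of_nat (Suc n) ^ Suc j * (lambert_term x (Suc n) + (lambert_term x (Suc n))\<^sup>2) / x) sums g' x"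
    "\<And>x. x \<in> S \<Longrightarrow> (g has_field_derivative g' x) (at x)"
    by blast
  have qS: "q \<in> S" and S: "open S" using q by (auto simp: S_def)
  have "g x = lambert_sum j x" if "x \<in> S" for x
    using g(1)[OF that] has_sum_imp_sums_Suc[OF has_sum_lambert[of x j]] that
    by (intro sums_unique2) (auto simp: S_def)
  moreover have "g' q = lambert_deriv j q / q"
    using g(2)[OF qS] sums_divide[OF has_sum_imp_sums_Suc[OF has_sum_lambert_deriv[OF q(1)]]]
    by (rule sums_unique2)
  ultimately show ?thesis
    using has_field_derivative_transform_within_open[OF g(3)[OF qS] S qS] by simp
qed

text \<open>Each Lambert term is a geometric series in \<open>q^d\<close>; collecting the pairs
  \<open>(d, m)\<close> by \<open>n = d m\<close> yields the divisor sums.\<close>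

lemma divisor_power_sum_sums:
  assumes q: "norm q < 1" "q \<noteq> 0"
  shows "(\<lambda>n. of_nat (divisor_power_sum j (Suc n)) * q ^ Suc n) sums lambert_sum j q"
proof -
  have "((\<lambda>(d, m). of_nat d ^ j * q ^ (d * m)) has_sum lambert_sum j q) ({1..} \<times> {1..})"
  proof (rule has_sum_SigmaI)
    fix d :: nat assume d: "d \<in> {1..}"
    have "norm (q ^ d) < 1"
      using d q by (simp add: norm_power power_less_one_iff)
    from has_sum_cmult_right[OF has_sum_geometric_from_1[OF this], of "of_nat d ^ j"]
    show "((\<lambda>m. case (d, m) of (d, m) \<Rightarrow> of_nat d ^ j * q ^ (d * m)) has_sum
        (of_nat d ^ j * lambert_term q d)) {1..}"
      by (simp add: lambert_term_def power_mult)
  next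
    show "((\<lambda>d. of_nat d ^ j * lambert_term q d) has_sum lambert_sum j q) {1..}"
      by (rule has_sum_lambert[OF q(1)])
    \<comment> \<open>From \<open>(a - 1) (b - 1) \<ge> 0\<close> follows
      \<open>a + b \<le> a b + 1\<close>; the excess 1 is the source of the factor
      \<open>1 / norm q\<close>.\<close>
    have "norm (q ^ (a * b)) \<le> 1 / norm q * norm q ^ (a + b)" if "a \<ge> 1" "b \<ge> 1" for a b
    proof -
      have "a + b \<le> Suc (a * b)"
        using that by (cases a; cases b) auto
      then have "norm q ^ Suc (a * b) \<le> norm q ^ (a + b)"
        using q by (intro power_decreasing) auto
      then show ?thesis using q by (simp add: norm_power field_simps)
    qed
    from summable_pairs[OF q(1) poly_bounded_power[OF poly_bounded_fst], of "1 / norm q"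
        "\<lambda>a b. q ^ (a * b)" j, OF _ this]
    show "(\<lambda>(d, m). of_nat d ^ j * q ^ (d * m)) summable_on {1..} \<times> {1..}"
      by (simp add: pos_pairs_def)
  qed
  then have "((\<lambda>(n, d). of_nat d ^ j * q ^ n) has_sum lambert_sum j q)
      (Sigma {1..} (\<lambda>n. {d. d dvd n}))"
    by (rule has_sum_reindex_bij_witness[of _ "\<lambda>(d, m). (d * m, d)" "\<lambda>(n, d). (d, n div d)",
          THEN iffD2, rotated -1])
       (auto simp: Suc_le_eq dvd_div_eq_0_iff elim!: dvdE)
  then have "((\<lambda>n. of_nat (divisor_power_sum j n) * q ^ n) has_sum lambert_sum j q) {1..}"
    by (rule has_sum_SigmaD)
       (auto intro!: has_sum_finiteI simp: divisor_power_sum_def sum_distrib_right)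
  then show ?thesis by (rule has_sum_imp_sums_Suc)
qed

text \<open>This value makes the constant term of \<open>G_2\<close> equal to \<open>-1/24\<close>,
  which has to match the factor \<open>q^(1/24)\<close> in \<eta> when \<open>D \<eta>\<close> is
  computed.\<close>

lemma bernoulli_2: "bernoulli 2 = 1 / 6"
proof -
  define E :: "complex fps" where "E = fps_exp 1 - 1"
  define F where "F = fps_X / E"
  have E1: "fps_nth E 1 = 1" by (simp add: E_def)
  then have "E \<noteq> 0" by auto
  \<comment> \<open>\<open>E\<close> has no constant term and is not invertible; the quotient is
    exact because \<open>E\<close> and \<open>fps_X\<close> both have subdegree 1. Comparing
    coefficients in \<open>F * E = fps_X\<close> then determines \<open>F\<close>.\<close>
  have "subdegree E = 1"
    by (rule subdegreeI) (auto simp: E_def)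
  then have "E dvd fps_X"
    using \<open>E \<noteq> 0\<close> by (subst fps_dvd_iff) auto
  then have FE: "F * E = fps_X"
    unfolding F_def by simp
  have n: "fps_nth (F * E) n = fps_nth fps_X n" for n by (simp only: FE)
  have 0: "fps_nth F 0 = 1"
    using n[of 1] by (simp add: fps_mult_nth E_def)
  have 1: "fps_nth F 1 = - 1 / 2"
    using n[of 2] 0 by (simp add: fps_mult_nth E_def eval_nat_numeral field_simps add_eq_0_iff)
  have "1 + (3 * fps_nth F 1 + 6 * fps_nth F 2) = 0"
    using n[of 3] 0 by (simp add: fps_mult_nth E_def eval_nat_numeral fact_numeral field_simps)
  then have "fps_nth F 2 = 1 / 12"
    unfolding 1 by (simp add: field_simps add_eq_0_iff2)
  then show ?thesis
    unfolding bernoulli_def F_def E_def by (simp add: mult.commute)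
qed

lemma norm_qpow_1:
  assumes "\<tau> \<in> \<H>"
  shows "norm (qpow 1 \<tau>) < 1"
  using assms by (simp add: qpow_def norm_exp_eq_Re upper_half_plane_def mult_pos_pos)

lemma qpow_nonzero: "qpow r \<tau> \<noteq> 0"
  by (simp add: qpow_def)

lemma open_upper_half_plane: "open \<H>"
  unfolding upper_half_plane_def by (rule open_halfspace_Im_gt)

lemma has_field_derivative_qpow:
  "(qpow r has_field_derivative (2 * of_real pi * \<i> * of_rat r * qpow r \<tau>)) (at \<tau>)"
  unfolding qpow_def by (auto intro!: derivative_eq_intros)

lemma eisenstein_G_eq:
  assumes "\<tau> \<in> \<H>"
  shows "eisenstein_G k \<tau> = - bernoulli k / (2 * of_nat k) + lambert_sum (k - 1) (qpow 1 \<tau>)"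
  unfolding eisenstein_G_def
  using sums_unique[OF divisor_power_sum_sums[OF norm_qpow_1[OF assms] qpow_nonzero]] by simp

lemma dedekind_eta_eq: "dedekind_eta \<tau> = qpow (1/24) \<tau> * euler_function (qpow 1 \<tau>)"
  by (simp add: dedekind_eta_def euler_function_def)

lemma dedekind_eta_nonzero:
  assumes "\<tau> \<in> \<H>"
  shows "dedekind_eta \<tau> \<noteq> 0"
  unfolding dedekind_eta_eq
  using euler_function_nonzero[OF norm_qpow_1[OF assms]] by (simp add: qpow_nonzero)

lemma has_field_derivative_lambert_sum_qpow:
  assumes "\<tau> \<in> \<H>"
  shows "((\<lambda>\<tau>. lambert_sum j (qpow 1 \<tau>)) has_field_derivative
    2 * of_real pi * \<i> * lambert_deriv j (qpow 1 \<tau>)) (at \<tau>)"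
  using DERIV_chain2[OF has_field_derivative_lambert_sum[OF norm_qpow_1[OF assms] qpow_nonzero]
      has_field_derivative_qpow[of 1 \<tau>], of j] qpow_nonzero[of 1 \<tau>]
  by (simp add: mult_ac)

lemma has_field_derivative_dedekind_eta:
  assumes "\<tau> \<in> \<H>"
  shows "(dedekind_eta has_field_derivative
    - (2 * of_real pi * \<i> * eisenstein_G 2 \<tau> * dedekind_eta \<tau>)) (at \<tau>)"
proof -
  define q where "q = qpow 1 \<tau>"
  have q: "norm q < 1" "q \<noteq> 0" using norm_qpow_1[OF assms] qpow_nonzero by (auto simp: q_def)
  have "((\<lambda>\<tau>. qpow (1/24) \<tau> * euler_function (qpow 1 \<tau>)) has_field_derivative
      2 * of_real pi * \<i> * of_rat (1/24) * qpow (1/24) \<tau> * euler_function q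
      + (- lambert_sum 1 q * euler_function q / q) * (2 * of_real pi * \<i> * of_rat 1 * q)
          * qpow (1/24) \<tau>) (at \<tau>)"
    unfolding q_def
    by (intro DERIV_mult DERIV_chain2[OF has_field_derivative_euler] has_field_derivative_qpow
        norm_qpow_1[OF assms] qpow_nonzero)
  also have "2 * of_real pi * \<i> * of_rat (1/24) * qpow (1/24) \<tau> * euler_function q
      + (- lambert_sum 1 q * euler_function q / q) * (2 * of_real pi * \<i> * of_rat 1 * q)
          * qpow (1/24) \<tau> = - (2 * of_real pi * \<i> * eisenstein_G 2 \<tau> * dedekind_eta \<tau>)"
    unfolding eisenstein_G_eq[OF assms] dedekind_eta_eq bernoulli_2
    using q(2) by (simp add: q_def[symmetric] of_rat_divide field_simps)
  finally show ?thesis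
    by (simp add: dedekind_eta_eq[abs_def])
qed

subsection \<open>The partial theta series\<close>

definition cis_exp :: "real \<Rightarrow> complex \<Rightarrow> complex" where
  "cis_exp \<alpha> \<tau> = exp (2 * of_real pi * \<i> * of_real \<alpha> * \<tau>)"

lemma norm_cis_exp: "norm (cis_exp \<alpha> \<tau>) = exp (- (2 * pi * Im \<tau>) * \<alpha>)"
  by (simp add: cis_exp_def norm_exp_eq_Re)

text \<open>Around \<open>x\<close> the disc of radius \<open>Im x / 2\<close> keeps the imaginary
  part above \<open>Im x / 2\<close>, which gives a majorant for the series. As the terms are
  holomorphic, no majorant for their derivatives is called for.\<close>

lemma cis_exp_series_deriv:
  fixes c :: "nat \<Rightarrow> complex" and \<alpha> :: "nat \<Rightarrow> real"
  assumes \<alpha>: "\<And>n. \<alpha> n \<ge> 0"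
    and c: "\<And>y. y > 0 \<Longrightarrow> summable (\<lambda>n. norm (c n) * exp (- y * \<alpha> n))"
    and \<tau>: "\<tau> \<in> \<H>"
  shows "((\<lambda>\<tau>. \<Sum>n. c n * cis_exp (\<alpha> n) \<tau>) has_field_derivative
      2 * of_real pi * \<i> * (\<Sum>n. of_real (\<alpha> n) * c n * cis_exp (\<alpha> n) \<tau>)) (at \<tau>)"
proof -
  have "\<exists>g g'. \<forall>x\<in>\<H>. (\<lambda>n. c n * cis_exp (\<alpha> n) x) sums g x \<and>
      (\<lambda>n. 2 * of_real pi * \<i> * (of_real (\<alpha> n) * c n * cis_exp (\<alpha> n) x)) sums g' x \<and>
      (g has_field_derivative g' x) (at x)"
  proof (rule series_and_derivative_comparison_local[OF open_upper_half_plane])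
    show "((\<lambda>x. c n * cis_exp (\<alpha> n) x) has_field_derivative
        2 * of_real pi * \<i> * (of_real (\<alpha> n) * c n * cis_exp (\<alpha> n) x)) (at x)" for n x
      unfolding cis_exp_def by (auto intro!: derivative_eq_intros)
    fix x assume "x \<in> \<H>"
    then have x: "Im x > 0" by (simp add: upper_half_plane_def)
    have "norm (c n * cis_exp (\<alpha> n) y) \<le> norm (c n) * exp (- (pi * Im x) * \<alpha> n)"
      if "y \<in> ball x (Im x / 2)" for n y
    proof -
      have "\<bar>Im x - Im y\<bar> \<le> dist x y"
        unfolding dist_norm using abs_Im_le_cmod[of "x - y"] by simp
      then have "Im x / 2 \<le> Im y" using that by simp
      then have "pi * Im x \<le> 2 * pi * Im y" using mult_left_mono[of "Im x / 2" "Im y" "2 * pi"] by simp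
      then have "- (2 * pi * Im y) * \<alpha> n \<le> - (pi * Im x) * \<alpha> n"
        using \<alpha>[of n] by (intro mult_right_mono) auto
      then show ?thesis
        unfolding norm_mult norm_cis_exp by (intro mult_left_mono) auto
    qed
    then show "\<exists>d h. 0 < d \<and> summable h \<and> (\<forall>\<^sub>F n in sequentially. \<forall>y\<in>ball x d \<inter> \<H>.
        norm (c n * cis_exp (\<alpha> n) y) \<le> h n)"
      using x c[of "pi * Im x"]
      by (intro exI[of _ "Im x / 2"] exI[of _ "\<lambda>n. norm (c n) * exp (- (pi * Im x) * \<alpha> n)"]) auto
  qed
  then obtain g g' where g: "\<And>x. x \<in> \<H> \<Longrightarrow> (\<lambda>n. c n * cis_exp (\<alpha> n) x) sums g x"
    "\<And>x. x \<in> \<H> \<Longrightarrow> (\<lambda>n. 2 * of_real pi * \<i> * (of_real (\<alpha> n) * c n * cis_exp (\<alpha> n) x)) sums g' x"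
    "\<And>x. x \<in> \<H> \<Longrightarrow> (g has_field_derivative g' x) (at x)"
    by blast
  have "(\<lambda>n. of_real (\<alpha> n) * c n * cis_exp (\<alpha> n) \<tau>) sums (g' \<tau> / (2 * of_real pi * \<i>))"
    using sums_divide[OF g(2)[OF \<tau>], of "2 * of_real pi * \<i>"] by simp
  then have "g' \<tau> = 2 * of_real pi * \<i> * (\<Sum>n. of_real (\<alpha> n) * c n * cis_exp (\<alpha> n) \<tau>)"
    by (simp add: sums_iff field_simps)
  moreover have "(\<Sum>n. c n * cis_exp (\<alpha> n) x) = g x" if "x \<in> \<H>" for x
    using g(1)[OF that] by (simp add: sums_iff)
  ultimately show ?thesis
    using has_field_derivative_transform_within_open[OF g(3)[OF \<tau>] open_upper_half_plane \<tau>] by simp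
qed

text \<open>
  Up to the factor \<open>(1 - \<zeta>) \<zeta>\<^sup>-\<^sup>1\<^sup>/\<^sup>2 q\<^sup>-\<^sup>1\<^sup>/\<^sup>2\<^sup>4\<close> the false theta function is
  \<open>\<Sum>\<^bsub>m\<ge>1\<^esub> \<chi>(m) q\<^bsup>m\<^sup>2/24\<^esup> \<zeta>\<^bsup>m/2\<^esup>\<close> with \<open>\<chi>\<close> the even character of conductor \<open>12\<close>.
  \<open>theta_part r k\<close> is the \<open>k\<close>-th Taylor coefficient (times \<open>k!\<close>) in \<open>u = 2 \<pi> i z\<close> of the
  part of this series over \<open>m = 6 n + r\<close>.
\<close>

definition theta_part :: "nat \<Rightarrow> nat \<Rightarrow> complex \<Rightarrow> complex" where
  "theta_part r k \<tau> =
     (\<Sum>n. ((-1) ^ n * (of_nat (6 * n + r) / 2) ^ k) * cis_exp (real (6 * n + r) ^ 2 / 24) \<tau>)"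

text \<open>The character is \<open>(-1)^n\<close> at \<open>6 n + 1\<close> and
  \<open>-(-1)^n\<close> at \<open>6 n + 5\<close>, and it vanishes at integers not prime to
  6.\<close>

definition theta_coeff :: "nat \<Rightarrow> complex \<Rightarrow> complex" where
  "theta_coeff k \<tau> = theta_part 1 k \<tau> - theta_part 5 k \<tau>"

lemma summable_theta_majorant:
  assumes "y > 0"
  shows "summable (\<lambda>n. norm ((-1) ^ n * (of_nat (6 * n + r) / 2 :: complex) ^ k)
           * exp (- y * (real (6 * n + r) ^ 2 / 24)))"
proof (rule summable_comparison_test_bigo)
  show "summable (\<lambda>n. norm (1 / real n ^ 2))"
    using inverse_power_summable[of 2, where 'a = real] by (simp add: inverse_eq_divide)
  have "(\<lambda>n. (real (6 * n + r) / 2) ^ k * exp (- y * (real (6 * n + r) ^ 2 / 24)))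
      \<in> O(\<lambda>n. 1 / real n ^ 2)"
    using assms unfolding of_nat_add of_nat_mult of_nat_numeral by real_asymp
  then show "(\<lambda>n. norm ((-1) ^ n * (of_nat (6 * n + r) / 2 :: complex) ^ k)
      * exp (- y * (real (6 * n + r) ^ 2 / 24))) \<in> O(\<lambda>n. 1 / real n ^ 2)"
    by (simp add: norm_mult norm_power norm_divide del: of_nat_add of_nat_mult)
qed

lemma theta_part_has_sum:
  assumes "\<tau> \<in> \<H>"
  shows "((\<lambda>n. ((-1) ^ n * (of_nat (6 * n + r) / 2) ^ k) * cis_exp (real (6 * n + r) ^ 2 / 24) \<tau>)
           has_sum theta_part r k \<tau>) UNIV"
proof -
  have "2 * pi * Im \<tau> > 0" using assms by (simp add: upper_half_plane_def)
  then have "summable (\<lambda>n. norm (((-1) ^ n * (of_nat (6 * n + r) / 2) ^ k)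
      * cis_exp (real (6 * n + r) ^ 2 / 24) \<tau>))"
    unfolding norm_mult[of "_ * _" "cis_exp _ _"] norm_cis_exp by (rule summable_theta_majorant)
  from norm_summable_imp_has_sum[OF this summable_sums[OF summable_norm_cancel[OF this]]]
  show ?thesis unfolding theta_part_def .
qed

text \<open>This is the heat equation at a single Taylor coefficient: \<open>D\<close> multiplies
  the term of \<open>m\<close> by \<open>m^2/24\<close>, whereas raising \<open>k\<close> by 2
  multiplies it by \<open>m^2/4\<close>.\<close>

lemma has_field_derivative_theta_part:
  assumes "\<tau> \<in> \<H>"
  shows "(theta_part r k has_field_derivative 2 * of_real pi * \<i> * theta_part r (k + 2) \<tau> / 6) (at \<tau>)"
proof -
  define c where "c = (\<lambda>n. (-1) ^ n * (of_nat (6 * n + r) / 2 :: complex) ^ k)"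
  define \<alpha> where "\<alpha> = (\<lambda>n. real (6 * n + r) ^ 2 / 24)"
  have "(theta_part r k has_field_derivative
      2 * of_real pi * \<i> * (\<Sum>n. of_real (\<alpha> n) * c n * cis_exp (\<alpha> n) \<tau>)) (at \<tau>)"
    unfolding theta_part_def c_def[symmetric] \<alpha>_def[symmetric] c_def[THEN fun_cong, symmetric]
      \<alpha>_def[THEN fun_cong, symmetric]
    by (rule cis_exp_series_deriv[OF _ _ assms])
       (use summable_theta_majorant in \<open>auto simp: c_def \<alpha>_def\<close>)
  also have "(\<lambda>n. of_real (\<alpha> n) * c n * cis_exp (\<alpha> n) \<tau>) =
      (\<lambda>n. ((-1) ^ n * (of_nat (6 * n + r) / 2) ^ (k + 2)) * cis_exp (real (6 * n + r) ^ 2 / 24) \<tau> / 6)"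
    by (simp add: \<alpha>_def c_def power_add power_divide power2_eq_square fun_eq_iff)
  also have "(\<Sum>n. ((-1) ^ n * (of_nat (6 * n + r) / 2) ^ (k + 2))
      * cis_exp (real (6 * n + r) ^ 2 / 24) \<tau> / 6) = theta_part r (k + 2) \<tau> / 6"
    by (intro sums_unique[symmetric] sums_divide has_sum_imp_sums theta_part_has_sum assms)
  finally show ?thesis by simp
qed

lemma has_field_derivative_theta_coeff:
  assumes "\<tau> \<in> \<H>"
  shows "(theta_coeff k has_field_derivative 2 * of_real pi * \<i> * theta_coeff (k + 2) \<tau> / 6) (at \<tau>)"
proof -
  have "((\<lambda>\<tau>. theta_part 1 k \<tau> - theta_part 5 k \<tau>) has_field_derivative
      2 * of_real pi * \<i> * theta_part 1 (k + 2) \<tau> / 6 - 2 * of_real pi * \<i> * theta_part 5 (k + 2) \<tau> / 6)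
      (at \<tau>)"
    by (intro DERIV_diff has_field_derivative_theta_part assms)
  then show ?thesis
    by (simp add: theta_coeff_def[abs_def] right_diff_distrib diff_divide_distrib)
qed

text \<open>The sums over \<open>n\<close> and over the exponential series are interchanged. The
  restriction on \<open>u\<close> makes the double series converge absolutely, the growth of
  \<open>exp (m |u|)\<close> being absorbed by the Gaussian decay in \<open>m\<close>.\<close>

lemma theta_part_expansion:
  assumes \<tau>: "\<tau> \<in> \<H>" and r: "r \<ge> 1" and u: "norm u \<le> pi * Im \<tau> / 12"
  obtains s where "(\<lambda>k. theta_part r k \<tau> / fact k * u ^ k) sums s"
    "(\<lambda>n. (-1) ^ n * cis_exp (real (6 * n + r) ^ 2 / 24) \<tau> * exp (of_nat (6 * n + r) / 2 * u)) sums s"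
proof -
  define m where "m = (\<lambda>n. real (6 * n + r) / 2)"
  define e where "e = (\<lambda>n. (-1) ^ n * cis_exp (real (6 * n + r) ^ 2 / 24) \<tau>)"
  define f where "f = (\<lambda>(n, k). e n * ((of_real (m n) * u) ^ k / fact k))"
  have Im: "Im \<tau> > 0" using \<tau> by (simp add: upper_half_plane_def)
  \<comment> \<open>The Gaussian factor is \<open>exp (-8 y m^2)\<close>. Since
    \<open>|u| \<le> 2 y\<close> and \<open>m \<ge> 1/2\<close>, the growth \<open>m |u|\<close> is
    at most \<open>4 y m^2\<close>, half of the decay; the other half still beats
    \<open>exp (- y n)\<close>.\<close>
  define y where "y = pi * Im \<tau> / 24"
  have y: "y > 0" using Im by (simp add: y_def)
  have m0: "m n \<ge> 0" for n by (simp add: m_def)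
  have ne: "norm (e n) = exp (- 8 * y * m n ^ 2)" for n
    by (simp add: e_def norm_mult norm_power norm_cis_exp m_def y_def power_divide)
  have bound: "norm (e n) * exp (m n * norm u) \<le> exp (- y * real n)" for n
  proof -
    have "real n \<le> m n" "1 / 2 \<le> m n" using r by (simp_all add: m_def)
    then have "real n * 1 \<le> m n * (2 * m n)" by (intro mult_mono) auto
    then have 1: "real n \<le> 4 * m n ^ 2" by (simp add: power2_eq_square)
    have "m n * 1 \<le> m n * (2 * m n)" using \<open>1 / 2 \<le> m n\<close> by (intro mult_left_mono m0) auto
    then have "m n * norm u \<le> (m n * (2 * m n)) * (2 * y)"
      using u m0[of n] by (intro mult_mono) (auto simp: y_def)
    then have "m n * norm u \<le> 4 * y * m n ^ 2" by (simp add: power2_eq_square mult_ac)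
    moreover have "y * real n \<le> y * (4 * m n ^ 2)" using 1 y by (intro mult_left_mono) auto
    ultimately have "- 8 * y * m n ^ 2 + m n * norm u \<le> - y * real n"
      by (simp add: algebra_simps)
    then show ?thesis unfolding ne exp_add[symmetric] by simp
  qed
  have exps: "((\<lambda>k. x ^ k / fact k) has_sum exp x) UNIV" for x :: complex
    using exp_converges[of x] summable_norm_exp[of x]
    by (intro norm_summable_imp_has_sum) (simp_all add: scaleR_conv_of_real field_simps norm_divide norm_power)
  have expr: "((\<lambda>k. x ^ k / fact k) has_sum exp x) UNIV" if "x \<ge> 0" for x :: real
    using exp_converges[of x] that
    by (intro sums_nonneg_imp_has_sum) (simp_all add: scaleR_conv_of_real field_simps)
  have bs: "summable (\<lambda>n. exp (- y * real n))"
    using summable_power_exp[OF y, of 0] by simp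
  have nsum: "(\<lambda>n. norm (e n) * exp (m n * norm u)) summable_on UNIV"
  proof (rule summable_on_comparison_test)
    show "(\<lambda>n. exp (- y * real n)) summable_on UNIV"
      by (rule summable_nonneg_imp_summable_on[OF bs]) simp
  qed (use bound in auto)
  have fsum: "f summable_on UNIV \<times> UNIV"
  proof (rule Infinite_Sum.abs_summable_summable, rule summable_on_SigmaI)
    show "((\<lambda>k. norm (f (n, k))) has_sum (norm (e n) * exp (m n * norm u))) UNIV" for n
      using has_sum_cmult_right[OF expr[of "m n * norm u"], of "norm (e n)"] m0[of n]
      by (simp add: f_def norm_mult norm_divide norm_power power_mult_distrib)
    show "(\<lambda>n. norm (e n) * exp (m n * norm u)) summable_on UNIV" by (rule nsum)
  qed auto
  have row: "((\<lambda>k. f (n, k)) has_sum (e n * exp (of_real (m n) * u))) UNIV" for n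
    unfolding f_def prod.case by (intro has_sum_cmult_right exps)
  define s where "s = infsum f (UNIV \<times> UNIV)"
  have fs: "(f has_sum s) (UNIV \<times> UNIV)" unfolding s_def by (rule has_sum_infsum[OF fsum])
  have rows: "((\<lambda>n. e n * exp (of_real (m n) * u)) has_sum s) UNIV"
    by (rule has_sum_SigmaD[OF fs row])
  then have rows': "(\<lambda>n. e n * exp (of_real (m n) * u)) sums s" by (rule has_sum_imp_sums)
  have fs': "((\<lambda>(k, n). f (n, k)) has_sum s) (UNIV \<times> UNIV)"
    using fs by (subst (asm) has_sum_swap)
  have col: "((\<lambda>n. case (k, n) of (k, n) \<Rightarrow> f (n, k)) has_sum (theta_part r k \<tau> / fact k * u ^ k)) UNIV"
    for k
    using has_sum_cmult_left[OF theta_part_has_sum[OF \<tau>, of r k], of "u ^ k / fact k"]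
    by (simp add: f_def e_def m_def power_mult_distrib power_divide mult_ac)
  have "(\<lambda>k. theta_part r k \<tau> / fact k * u ^ k) sums s"
    by (rule has_sum_imp_sums[OF has_sum_SigmaD[OF fs' col]])
  moreover have "(\<lambda>n. (-1) ^ n * cis_exp (real (6 * n + r) ^ 2 / 24) \<tau> * exp (of_nat (6 * n + r) / 2 * u)) sums s"
    using rows' by (simp add: e_def m_def)
  ultimately show ?thesis by (rule that)
qed

text \<open>This is the series \<open>T\<close> as a function of \<open>u\<close>. It has no factor
  \<open>1 - exp u\<close>, so it does not vanish at \<open>u = 0\<close>.\<close>

definition false_theta_factor :: "complex \<Rightarrow> complex \<Rightarrow> complex" where
  "false_theta_factor \<tau> u = exp (u / 2) * (qpow (1/24) \<tau> *
     (\<Sum>n. (-1) ^ n * exp u ^ (3 * n) * qpow 1 \<tau> ^ (n * (3 * n + 1) div 2)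
              * (1 - (exp u)\<^sup>2 * qpow 1 \<tau> ^ (2 * n + 1))))"

text \<open>Completing squares: \<open>n (3 n + 1)/2 + 1/24 = (6 n + 1)^2/24\<close>, and adding
  \<open>2 n + 1\<close> gives \<open>(6 n + 5)^2/24\<close>. The exponents of \<zeta> are
  \<open>3 n + 1/2\<close> and \<open>3 n + 5/2\<close>.\<close>

lemma false_theta_term:
  "(-1) ^ n * cis_exp (real (6 * n + 1) ^ 2 / 24) \<tau> * exp (of_nat (6 * n + 1) / 2 * u)
   - (-1) ^ n * cis_exp (real (6 * n + 5) ^ 2 / 24) \<tau> * exp (of_nat (6 * n + 5) / 2 * u)
   = exp (u / 2) * (qpow (1/24) \<tau> *
     ((-1) ^ n * exp u ^ (3 * n) * qpow 1 \<tau> ^ (n * (3 * n + 1) div 2)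
              * (1 - (exp u)\<^sup>2 * qpow 1 \<tau> ^ (2 * n + 1))))"
proof -
  define t where "t = 2 * of_real pi * \<i> * \<tau>"
  define N where "N = n * (3 * n + 1) div 2"
  \<comment> \<open>Parity is what turns the integer division in the exponent into a division of
    complex numbers.\<close>
  have "even (n * (3 * n + 1))" by simp
  then have "of_nat (2 * N) = (of_nat (n * (3 * n + 1)) :: complex)"
    unfolding N_def by (simp only: dvd_mult_div_cancel)
  then have p: "of_nat N = (of_nat n * (3 * of_nat n + 1) / 2 :: complex)"
    by (simp add: field_simps)
  have qp: "qpow 1 \<tau> ^ k = exp (of_nat k * t)" for k
    by (simp add: qpow_def t_def exp_of_nat_mult)
  have q24: "qpow (1/24) \<tau> = exp (t / 24)"
    by (simp add: qpow_def t_def of_rat_divide mult_ac)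
  have ep: "exp u ^ k = exp (of_nat k * u)" for k
    by (simp add: exp_of_nat_mult)
  have c: "cis_exp (real m ^ 2 / 24) \<tau> = exp (of_nat m ^ 2 / 24 * t)" for m
    by (simp add: cis_exp_def t_def mult_ac)
  have 1: "exp (of_nat (6 * n + 1) ^ 2 / 24 * t) * exp (of_nat (6 * n + 1) / 2 * u)
      = exp (u / 2) * exp (t / 24) * (exp (of_nat (3 * n) * u) * exp (of_nat N * t))"
    unfolding p exp_add[symmetric] by (rule arg_cong[of _ _ exp]) (simp add: field_simps power2_eq_square)
  have 2: "exp (of_nat (6 * n + 5) ^ 2 / 24 * t) * exp (of_nat (6 * n + 5) / 2 * u)
      = exp (u / 2) * exp (t / 24) * (exp (of_nat (3 * n) * u) * exp (of_nat N * t))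
        * (exp (of_nat 2 * u) * exp (of_nat (2 * n + 1) * t))"
    unfolding p exp_add[symmetric] by (rule arg_cong[of _ _ exp]) (simp add: field_simps power2_eq_square)
  show ?thesis
    unfolding N_def[symmetric] c qp q24 ep mult.assoc[of "(-1) ^ n"] 1 2 by (simp add: algebra_simps)
qed

lemma false_theta_factor_sums:
  assumes \<tau>: "\<tau> \<in> \<H>" and u: "norm u \<le> pi * Im \<tau> / 12"
  shows "(\<lambda>k. theta_coeff k \<tau> / fact k * u ^ k) sums false_theta_factor \<tau> u"
proof -
  obtain s1 where s1: "(\<lambda>k. theta_part 1 k \<tau> / fact k * u ^ k) sums s1"
    "(\<lambda>n. (-1) ^ n * cis_exp (real (6 * n + 1) ^ 2 / 24) \<tau> * exp (of_nat (6 * n + 1) / 2 * u)) sums s1"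
    using theta_part_expansion[OF \<tau> _ u, of 1] by auto
  obtain s5 where s5: "(\<lambda>k. theta_part 5 k \<tau> / fact k * u ^ k) sums s5"
    "(\<lambda>n. (-1) ^ n * cis_exp (real (6 * n + 5) ^ 2 / 24) \<tau> * exp (of_nat (6 * n + 5) / 2 * u)) sums s5"
    using theta_part_expansion[OF \<tau> _ u, of 5] by auto
  define F where "F = (\<lambda>n. (-1) ^ n * exp u ^ (3 * n) * qpow 1 \<tau> ^ (n * (3 * n + 1) div 2)
              * (1 - (exp u)\<^sup>2 * qpow 1 \<tau> ^ (2 * n + 1)))"
  define c where "c = exp (u / 2) * qpow (1/24) \<tau>"
  have c0: "c \<noteq> 0" by (simp add: c_def qpow_nonzero)
  have "(\<lambda>n. c * F n) sums (s1 - s5)"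
    using sums_diff[OF s1(2) s5(2)] unfolding false_theta_term by (simp add: F_def c_def mult.assoc)
  then have "F sums ((s1 - s5) / c)"
    using sums_divide[of "\<lambda>n. c * F n" _ c] c0 by simp
  then have "false_theta_factor \<tau> u = s1 - s5"
    unfolding false_theta_factor_def F_def[symmetric] using c0
    by (simp add: sums_iff c_def[symmetric] mult.assoc[symmetric])
  moreover have "(\<lambda>k. theta_coeff k \<tau> / fact k * u ^ k) sums (s1 - s5)"
    using sums_diff[OF s1(1) s5(1)] by (simp add: theta_coeff_def diff_divide_distrib left_diff_distrib)
  ultimately show ?thesis by simp
qed

definition theta_fps :: "complex \<Rightarrow> complex fps" where
  "theta_fps \<tau> = Abs_fps (\<lambda>k. theta_coeff k \<tau> / fact k)"

lemma false_theta_factor_has_fps_expansion: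
  assumes "\<tau> \<in> \<H>"
  shows "false_theta_factor \<tau> has_fps_expansion theta_fps \<tau>"
proof (rule has_fps_expansionI)
  have "eventually (\<lambda>u. u \<in> ball 0 (pi * Im \<tau> / 12)) (nhds (0 :: complex))"
    using assms by (intro eventually_nhds_in_open) (auto simp: upper_half_plane_def)
  then show "\<forall>\<^sub>F u in nhds 0. (\<lambda>n. fps_nth (theta_fps \<tau>) n * u ^ n) sums false_theta_factor \<tau> u"
  proof eventually_elim
    case (elim u)
    then show ?case
      using false_theta_factor_sums[OF assms, of u] by (simp add: theta_fps_def)
  qed
qed

lemma theta_coeff_0:
  assumes "\<tau> \<in> \<H>"
  shows "theta_coeff 0 \<tau> = dedekind_eta \<tau>"
proof -
  have "theta_coeff 0 \<tau> = false_theta_factor \<tau> 0"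
    using has_fps_expansion_imp_0_eq_fps_nth_0[OF false_theta_factor_has_fps_expansion[OF assms]]
    by (simp add: theta_fps_def)
  also have "\<dots> = dedekind_eta \<tau>"
    unfolding dedekind_eta_eq false_theta_factor_def
    using sums_unique[OF pentagonal_number[OF norm_qpow_1[OF assms]]] by simp
  finally show ?thesis .
qed

subsection \<open>The false Eisenstein series\<close>

text \<open>\<open>T = \<eta> exp (- \<Sum> h_k u^k / k!)\<close> gives
  \<open>- T'/T = \<Sum> h_(k+1) u^k / k!\<close>, with the sum starting at \<open>k = 0\<close>.
  Hence coefficient \<open>k\<close> belongs to \<open>h_(k+1)\<close>.\<close>

definition eisenstein_fps :: "complex \<Rightarrow> complex fps" where
  "eisenstein_fps \<tau> = - fps_deriv (theta_fps \<tau>) * inverse (theta_fps \<tau>)"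

lemma theta_fps_nth_0:
  assumes "\<tau> \<in> \<H>"
  shows "fps_nth (theta_fps \<tau>) 0 = dedekind_eta \<tau>"
  using theta_coeff_0[OF assms] by (simp add: theta_fps_def)

lemma theta_fps_nonzero:
  assumes "\<tau> \<in> \<H>"
  shows "theta_fps \<tau> \<noteq> 0"
  using theta_fps_nth_0[OF assms] dedekind_eta_nonzero[OF assms] by auto

lemma fps_deriv_theta:
  assumes "\<tau> \<in> \<H>"
  shows "fps_deriv (theta_fps \<tau>) = - (eisenstein_fps \<tau> * theta_fps \<tau>)"
  using inverse_mult_eq_1[of "theta_fps \<tau>"] theta_fps_nth_0[OF assms] dedekind_eta_nonzero[OF assms]
  by (simp add: eisenstein_fps_def mult.assoc)

text \<open>Used with \<open>c = 2 \<pi> i\<close> to pass from the variable \<open>z\<close> to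
  \<open>u\<close>.\<close>

lemma eventually_nhds_scale:
  fixes c :: complex
  assumes "c \<noteq> 0"
  shows "eventually (\<lambda>z. P (c * z)) (nhds 0) \<longleftrightarrow> eventually P (nhds 0)"
proof -
  have lim: "filterlim (\<lambda>z. d * z) (nhds 0) (nhds 0)" for d :: complex
    using isCont_mult[OF continuous_const[of _ d] continuous_ident, of 0]
    unfolding isCont_def tendsto_at_iff_tendsto_nhds by simp
  show ?thesis
  proof
    assume "eventually P (nhds 0)"
    then show "eventually (\<lambda>z. P (c * z)) (nhds 0)"
      using lim by (rule eventually_compose_filterlim)
  next
    assume "eventually (\<lambda>z. P (c * z)) (nhds 0)"
    then have "eventually (\<lambda>z. P (c * (1 / c * z))) (nhds 0)"
      using lim by (rule eventually_compose_filterlim)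
    then show "eventually P (nhds 0)" using assms by simp
  qed
qed

lemma eventually_exp_noteq_1: "eventually (\<lambda>u :: complex. u \<noteq> 0 \<longrightarrow> exp u \<noteq> 1) (nhds 0)"
proof -
  have "eventually (\<lambda>u :: complex. u \<in> ball 0 1) (nhds 0)"
    by (rule eventually_nhds_in_open) auto
  then show ?thesis
  proof (eventually_elim, intro impI notI)
    fix u :: complex
    assume u: "u \<in> ball 0 1" "u \<noteq> 0" "exp u = 1"
    then obtain n :: int where n: "Re u = 0" "Im u = of_int (2 * n) * pi"
      by (auto simp: exp_eq_1)
    have "n = 0"
    proof (rule ccontr)
      assume "n \<noteq> 0"
      then have "1 * 1 \<le> \<bar>of_int (2 * n) :: real\<bar> * pi"
        using pi_gt3 by (intro mult_mono) linarith+
      then have "1 \<le> \<bar>Im u\<bar>" by (simp add: n abs_mult)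
      then show False using u(1) abs_Im_le_cmod[of u] by simp
    qed
    then show False using n u(2) by (simp add: complex_eq_iff)
  qed
qed

lemma false_theta_eq_factor:
  "false_theta (exp u) (qpow 1 \<tau>) * qpow (1/24) \<tau> = (1 - exp u) * exp (- (u / 2)) * false_theta_factor \<tau> u"
  unfolding false_theta_def false_theta_factor_def by (simp add: exp_minus field_simps)

lemma two_sin_half: "- 2 * \<i> * sin (u / (2 * \<i>)) = (1 - exp u) * exp (- (u / 2))"
proof -
  have "exp u = exp (u / 2) * exp (u / 2)" by (simp flip: exp_add)
  then have "(1 - exp u) * exp (- (u / 2)) = exp (- (u / 2)) - exp (u / 2)"
    by (simp add: exp_minus field_simps)
  moreover have "\<i> * (u / (2 * \<i>)) = u / 2" "- (\<i> * (u / (2 * \<i>))) = - (u / 2)"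
    by auto
  ultimately show ?thesis
    unfolding sin_exp_eq by (simp add: field_simps)
qed

lemma qpow_minus: "qpow (- r) \<tau> * qpow r \<tau> = 1"
  unfolding qpow_def exp_add[symmetric] by (simp add: of_rat_minus)

text \<open>Division by the factor \<open>1 - \<zeta>\<close> is legitimate as it vanishes only at \<open>z = 0\<close>.\<close>

lemma false_eisenstein_expansion_iff:
  assumes \<tau>: "\<tau> \<in> \<H>"
  shows "false_eisenstein_expansion \<tau> a \<longleftrightarrow> a 0 = 0 \<and>
    (\<forall>\<^sub>F u in nhds 0. \<exists>S. (\<lambda>k. a k / fact k * u ^ k) sums S \<and>
       false_theta_factor \<tau> u = dedekind_eta \<tau> * exp (- S))"
    (is "_ \<longleftrightarrow> _ \<and> ?R")
proof (cases "a 0 = 0")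
  case True
  define P where "P = (\<lambda>u. \<exists>S. (\<lambda>k. a (Suc k) * u ^ Suc k / fact (Suc k)) sums S \<and>
        false_theta (exp u) (qpow 1 \<tau>) =
          - 2 * \<i> * sin (u / (2 * \<i>)) * qpow (- 1/24) \<tau> * dedekind_eta \<tau> * exp (- S))"
  have z: "2 * of_real pi * \<i> * z / (2 * \<i>) = of_real pi * z" for z :: complex
    by (subst nonzero_divide_eq_eq) (simp_all add: mult_ac)
  have "false_eisenstein_expansion \<tau> a \<longleftrightarrow> eventually (\<lambda>z. P (2 * of_real pi * \<i> * z)) (nhds 0)"
    unfolding false_eisenstein_expansion_def P_def z by (simp only: True simp_thms)
  also have "\<dots> \<longleftrightarrow> eventually P (nhds 0)"
    by (rule eventually_nhds_scale) simp
  also have "\<dots> \<longleftrightarrow> ?R"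
  proof (rule eventually_subst)
    have sum: "(\<lambda>k. a (Suc k) * u ^ Suc k / fact (Suc k)) sums S \<longleftrightarrow> (\<lambda>k. a k / fact k * u ^ k) sums S"
      for u S
      using sums_Suc_iff[of "\<lambda>k. a k / fact k * u ^ k" S] True by (simp del: power_Suc fact_Suc)
    have zero: "false_theta_factor \<tau> 0 = dedekind_eta \<tau>"
      using has_fps_expansion_imp_0_eq_fps_nth_0[OF false_theta_factor_has_fps_expansion[OF \<tau>]]
      by (simp add: theta_fps_nth_0[OF \<tau>])
    show "\<forall>\<^sub>F u in nhds 0. P u \<longleftrightarrow> (\<exists>S. (\<lambda>k. a k / fact k * u ^ k) sums S \<and>
       false_theta_factor \<tau> u = dedekind_eta \<tau> * exp (- S))"
      using eventually_exp_noteq_1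
    proof eventually_elim
      case (elim u)
      show ?case
      proof (cases "u = 0")
        \<comment> \<open>At \<open>u = 0\<close> the original equation reads \<open>0 = 0\<close>,
          whereas the reduced one reads \<open>T(0) = \<eta>\<close>; both hold, with
          \<open>S = 0\<close>.\<close>
        case u: True
        have s0: "(\<lambda>k. a k / fact k * 0 ^ k) sums S \<longleftrightarrow> S = 0" for S
          using powser_sums_zero_iff[of "\<lambda>k. a k / fact k" S] True by auto
        show ?thesis
          unfolding P_def sum u s0 by (simp add: zero false_theta_def)
      next
        case False
        define c where "c = (1 - exp u) * exp (- (u / 2))"
        have c: "c \<noteq> 0" using elim False by (simp add: c_def)
        have "false_theta (exp u) (qpow 1 \<tau>) =
            - 2 * \<i> * sin (u / (2 * \<i>)) * qpow (- 1/24) \<tau> * dedekind_eta \<tau> * exp (- S) \<longleftrightarrow>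
            false_theta_factor \<tau> u = dedekind_eta \<tau> * exp (- S)" for S
        proof -
          have "false_theta (exp u) (qpow 1 \<tau>) = c * qpow (- 1/24) \<tau> * false_theta_factor \<tau> u"
          proof -
            have "qpow (1/24) \<tau> * qpow (- 1/24) \<tau> = 1"
              using qpow_minus[of "1/24" \<tau>] by (simp add: mult.commute)
            then have "false_theta (exp u) (qpow 1 \<tau>)
                = (false_theta (exp u) (qpow 1 \<tau>) * qpow (1/24) \<tau>) * qpow (- 1/24) \<tau>"
              by (simp only: mult.assoc mult_1_right)
            then show ?thesis
              unfolding false_theta_eq_factor c_def by (simp only: mult_ac)
          qed
          then show ?thesis
            unfolding two_sin_half c_def[symmetric] using c qpow_nonzero[of "-1/24" \<tau>]
            by (simp add: mult.assoc)
        qed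
        then show ?thesis unfolding P_def sum by simp
      qed
    qed
  qed
  finally show ?thesis using True by simp
qed (simp add: false_eisenstein_expansion_def)

text \<open>The value of \<open>exp (- S)\<close> fixes \<open>S\<close> only up to multiples of
  \<open>2 \<pi> i\<close>. Differentiation removes this ambiguity: the derivative of the sum is
  \<open>- T'/T\<close>, which determines all coefficients of positive index.\<close>

lemma false_eisenstein_expansion_unique:
  assumes \<tau>: "\<tau> \<in> \<H>" and a: "false_eisenstein_expansion \<tau> a"
  shows "a (Suc k) = fact k * fps_nth (eisenstein_fps \<tau>) k"
proof -
  define A where "A = Abs_fps (\<lambda>k. a k / fact k)"
  define g where "g = (\<lambda>u. \<Sum>k. a k / fact k * u ^ k)"
  have ev: "\<forall>\<^sub>F u in nhds 0. \<exists>S. (\<lambda>k. a k / fact k * u ^ k) sums S \<and>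
       false_theta_factor \<tau> u = dedekind_eta \<tau> * exp (- S)"
    using a false_eisenstein_expansion_iff[OF \<tau>] by blast
  have g: "g has_fps_expansion A"
    by (rule has_fps_expansionI, use ev in eventually_elim) (auto simp: A_def g_def sums_iff)
  have fg: "\<forall>\<^sub>F u in nhds 0. false_theta_factor \<tau> u = dedekind_eta \<tau> * exp (- g u)"
    using ev by eventually_elim (auto simp: g_def sums_iff)
  obtain s where s: "open s" "0 \<in> s" "g holomorphic_on s"
    using has_fps_expansion_imp_holomorphic[OF g] by metis
  \<comment> \<open>To differentiate at a nearby point \<open>u\<close>, the equation must hold in a
    neighbourhood of \<open>u\<close>; hence the nested use of \<open>eventually\<close>.\<close>
  have dev: "\<forall>\<^sub>F u in nhds 0. deriv (false_theta_factor \<tau>) u = - (deriv g u * false_theta_factor \<tau> u)"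
    using fg[THEN eventually_eventually[THEN iffD2]] eventually_nhds_in_open[OF s(1,2)]
  proof eventually_elim
    case (elim u)
    have "(g has_field_derivative deriv g u) (at u)"
      by (rule holomorphic_derivI[OF s(3,1) elim(2)])
    then have "((\<lambda>u. dedekind_eta \<tau> * exp (- g u)) has_field_derivative
        - (deriv g u * (dedekind_eta \<tau> * exp (- g u)))) (at u)"
      by (auto intro!: derivative_eq_intros)
    then have "deriv (\<lambda>u. dedekind_eta \<tau> * exp (- g u)) u
        = - (deriv g u * (dedekind_eta \<tau> * exp (- g u)))"
      by (rule DERIV_imp_deriv)
    moreover have "deriv (false_theta_factor \<tau>) u = deriv (\<lambda>u. dedekind_eta \<tau> * exp (- g u)) u"
      by (rule deriv_cong_ev[OF elim(1) refl])
    moreover have "false_theta_factor \<tau> u = dedekind_eta \<tau> * exp (- g u)"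
      using elim(1) by (rule eventually_nhds_x_imp_x)
    ultimately show ?case by simp
  qed
  have "(\<lambda>u. - (deriv g u * false_theta_factor \<tau> u)) has_fps_expansion
      - (fps_deriv A * theta_fps \<tau>)"
    by (intro has_fps_expansion_minus has_fps_expansion_mult has_fps_expansion_deriv g
        false_theta_factor_has_fps_expansion \<tau>)
  then have "deriv (false_theta_factor \<tau>) has_fps_expansion - (fps_deriv A * theta_fps \<tau>)"
    by (rule has_fps_expansion_cong[OF dev refl, THEN iffD2])
  moreover have "deriv (false_theta_factor \<tau>) has_fps_expansion fps_deriv (theta_fps \<tau>)"
    by (intro has_fps_expansion_deriv false_theta_factor_has_fps_expansion \<tau>)
  ultimately have "fps_deriv (theta_fps \<tau>) = - (fps_deriv A * theta_fps \<tau>)"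
    using fps_expansion_unique_complex by blast
  then have "fps_deriv A = eisenstein_fps \<tau>"
    using fps_deriv_theta[OF \<tau>] theta_fps_nonzero[OF \<tau>] by simp
  then have "fps_nth (eisenstein_fps \<tau>) k = fps_nth (fps_deriv A) k" by simp
  also have "\<dots> = a (Suc k) / fact k"
    by (simp add: A_def del: of_nat_Suc)
  finally show ?thesis by simp
qed

lemma false_eisenstein_expansion_exists:
  assumes \<tau>: "\<tau> \<in> \<H>"
  shows "\<exists>a. false_eisenstein_expansion \<tau> a"
proof -
  define f where "f = (\<lambda>u. false_theta_factor \<tau> u / dedekind_eta \<tau>)"
  note eta = dedekind_eta_nonzero[OF \<tau>]
  have f: "f has_fps_expansion fps_const (1 / dedekind_eta \<tau>) * theta_fps \<tau>"
    using has_fps_expansion_cmult_left[OF false_theta_factor_has_fps_expansion[OF \<tau>], of "1 / dedekind_eta \<tau>"]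
    by (simp add: f_def)
  have f0: "f 0 = 1"
    using has_fps_expansion_imp_0_eq_fps_nth_0[OF f] theta_fps_nth_0[OF \<tau>] eta by simp
  have fa: "f analytic_on {0}" by (rule has_fps_expansion_imp_analytic_0[OF f])
  \<comment> \<open>Since \<open>f 0 = 1\<close> lies off the branch cut, the principal logarithm is
    analytic there, and \<open>Ln 1 = 0\<close> yields the normalisation
    \<open>a 0 = 0\<close>.\<close>
  define L where "L = (\<lambda>u. - Ln (f u))"
  have "L analytic_on {0}"
    unfolding L_def by (intro analytic_intros fa) (simp add: f0)
  then obtain A where A: "L has_fps_expansion A"
    using analytic_at_imp_has_fps_expansion_0 by blast
  define a where "a = (\<lambda>k. fact k * fps_nth A k)"
  have "L 0 = fps_nth A 0" by (rule has_fps_expansion_imp_0_eq_fps_nth_0[OF A])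
  then have a0: "a 0 = 0" by (simp add: a_def L_def f0)
  have "isCont f 0" using has_fps_expansion_imp_continuous[OF f, of UNIV] by simp
  then have "\<forall>\<^sub>F u in nhds 0. f u \<noteq> 0"
    unfolding continuous_at tendsto_at_iff_tendsto_nhds
    by (rule tendsto_imp_eventually_ne) (simp add: f0)
  moreover have "\<forall>\<^sub>F u in nhds 0. (\<lambda>k. a k / fact k * u ^ k) sums L u"
  proof -
    have "\<forall>\<^sub>F u in nhds 0. u \<in> eball (0 :: complex) (fps_conv_radius A)"
      using A by (intro eventually_nhds_in_open) (auto simp: has_fps_expansion_def zero_ereal_def)
    moreover have "\<forall>\<^sub>F u in nhds 0. eval_fps A u = L u"
      using A by (simp add: has_fps_expansion_def)
    ultimately show ?thesis
    proof eventually_elim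
      case (elim u)
      then show ?case
        using sums_eval_fps[of u A] by (simp add: a_def in_eball_iff)
    qed
  qed
  ultimately have "\<forall>\<^sub>F u in nhds 0. \<exists>S. (\<lambda>k. a k / fact k * u ^ k) sums S \<and>
       false_theta_factor \<tau> u = dedekind_eta \<tau> * exp (- S)"
  proof eventually_elim
    case (elim u)
    have "dedekind_eta \<tau> * exp (- L u) = false_theta_factor \<tau> u"
      using elim(1) eta by (simp add: L_def f_def)
    then show ?case using elim(2) by metis
  qed
  then show ?thesis
    using a0 false_eisenstein_expansion_iff[OF \<tau>] by blast
qed

lemma false_eisenstein_Suc:
  assumes \<tau>: "\<tau> \<in> \<H>"
  shows "false_eisenstein (Suc k) \<tau> = fact k * fps_nth (eisenstein_fps \<tau>) k"
proof -
  have "\<exists>!a. false_eisenstein_expansion \<tau> a"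
  proof (rule ex_ex1I[OF false_eisenstein_expansion_exists[OF \<tau>]])
    fix a b assume ab: "false_eisenstein_expansion \<tau> a" "false_eisenstein_expansion \<tau> b"
    show "a = b"
    proof
      fix k show "a k = b k"
        using ab false_eisenstein_expansion_unique[OF \<tau> ab(1)] false_eisenstein_expansion_unique[OF \<tau> ab(2)]
          false_eisenstein_expansion_iff[OF \<tau>]
        by (cases k) simp_all
    qed
  qed
  from theI'[OF this] show ?thesis
    unfolding false_eisenstein_def by (rule false_eisenstein_expansion_unique[OF \<tau>])
qed

section \<open>The action of \<open>D\<close> on the Taylor coefficients in \<open>u\<close>\<close>

definition theta_fps_D :: "complex \<Rightarrow> complex fps" where
  "theta_fps_D \<tau> = Abs_fps (\<lambda>k. theta_coeff (k + 2) \<tau> / 6 / fact k)"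

text \<open>The heat equation holds by construction, since \<open>theta_fps_D\<close> collects the
  derivatives of the coefficients in the form given by
  \<open>has_field_derivative_theta_coeff\<close>.\<close>

lemma theta_fps_D_eq: "6 * theta_fps_D \<tau> = fps_deriv (fps_deriv (theta_fps \<tau>))"
  by (rule fps_ext) (simp add: theta_fps_D_def theta_fps_def field_simps del: of_nat_Suc)

lemma has_field_derivative_theta_fps_nth:
  assumes "\<tau> \<in> \<H>"
  shows "((\<lambda>\<tau>. fps_nth (theta_fps \<tau>) k) has_field_derivative
     2 * of_real pi * \<i> * fps_nth (theta_fps_D \<tau>) k) (at \<tau>)"
  using DERIV_cdivide[OF has_field_derivative_theta_coeff[OF assms, of k], of "fact k"]
  by (simp add: theta_fps_def theta_fps_D_def)

text \<open>Solving \<open>T' = - W T\<close> for the leading coefficient shows, by recursion, that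
  the coefficients of \<open>W\<close> are rational expressions in those of \<open>T\<close> whose
  denominators are powers of \<eta>.\<close>

lemma eisenstein_fps_nth_field_differentiable:
  assumes \<tau>: "\<tau> \<in> \<H>"
  shows "(\<lambda>\<tau>. fps_nth (eisenstein_fps \<tau>) k) field_differentiable (at \<tau>)"
proof (induction k rule: less_induct)
  case (less k)
  define F where "F = (\<lambda>\<tau>. (- (of_nat (Suc k) * fps_nth (theta_fps \<tau>) (Suc k))
    - (\<Sum>i<k. fps_nth (eisenstein_fps \<tau>) i * fps_nth (theta_fps \<tau>) (k - i))) / fps_nth (theta_fps \<tau>) 0)"
  have T: "(\<lambda>\<tau>. fps_nth (theta_fps \<tau>) j) field_differentiable (at \<tau>)" for j
    using has_field_derivative_theta_fps_nth[OF \<tau>] by (auto simp: field_differentiable_def)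
  have "F field_differentiable (at \<tau>)"
    unfolding F_def using dedekind_eta_nonzero[OF \<tau>] theta_fps_nth_0[OF \<tau>]
    by (intro field_differentiable_divide field_differentiable_diff field_differentiable_minus
        field_differentiable_sum field_differentiable_mult field_differentiable_const T less) auto
  moreover have "F x = fps_nth (eisenstein_fps x) k" if "x \<in> \<H>" for x
  proof -
    have "fps_nth (fps_deriv (theta_fps x)) k = - fps_nth (eisenstein_fps x * theta_fps x) k"
      by (simp only: fps_deriv_theta[OF that] fps_neg_nth)
    also have "fps_nth (eisenstein_fps x * theta_fps x) k =
        (\<Sum>i<k. fps_nth (eisenstein_fps x) i * fps_nth (theta_fps x) (k - i))
        + fps_nth (eisenstein_fps x) k * fps_nth (theta_fps x) 0"
      by (simp add: fps_mult_nth atLeast0AtMost lessThan_Suc_atMost[symmetric])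
    finally have "- (of_nat (Suc k) * fps_nth (theta_fps x) (Suc k))
        - (\<Sum>i<k. fps_nth (eisenstein_fps x) i * fps_nth (theta_fps x) (k - i))
        = fps_nth (eisenstein_fps x) k * fps_nth (theta_fps x) 0"
      by (simp del: of_nat_Suc)
    then show ?thesis
      using dedekind_eta_nonzero[OF that] theta_fps_nth_0[OF that]
      unfolding F_def by simp
  qed
  ultimately show ?case
    using \<tau> open_upper_half_plane
    by (auto simp: field_differentiable_def intro: has_field_derivative_transform_within_open)
qed

definition eisenstein_fps_D :: "complex \<Rightarrow> complex fps" where
  "eisenstein_fps_D \<tau> = Abs_fps (\<lambda>k. deriv (\<lambda>\<tau>. fps_nth (eisenstein_fps \<tau>) k) \<tau> / (2 * of_real pi * \<i>))"

lemma has_field_derivative_eisenstein_fps_nth: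
  assumes "\<tau> \<in> \<H>"
  shows "((\<lambda>\<tau>. fps_nth (eisenstein_fps \<tau>) k) has_field_derivative
     2 * of_real pi * \<i> * fps_nth (eisenstein_fps_D \<tau>) k) (at \<tau>)"
  using eisenstein_fps_nth_field_differentiable[OF assms, of k]
  by (simp add: eisenstein_fps_D_def field_differentiable_derivI)

text \<open>This is \<open>D\<close> applied to \<open>T' = - W T\<close> coefficient by
  coefficient; each coefficient of a product is a finite sum, so the product rule carries over, and
  \<open>D\<close> commutes with the derivative in \<open>u\<close>.\<close>

lemma fps_deriv_theta_D:
  assumes \<tau>: "\<tau> \<in> \<H>"
  shows "fps_deriv (theta_fps_D \<tau>) =
    - (eisenstein_fps_D \<tau> * theta_fps \<tau> + eisenstein_fps \<tau> * theta_fps_D \<tau>)"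
proof (rule fps_ext)
  fix k
  define c where "c = 2 * of_real pi * \<i>"
  have c: "c \<noteq> 0" by (simp add: c_def)
  have "((\<lambda>\<tau>. - (\<Sum>i=0..k. fps_nth (eisenstein_fps \<tau>) i * fps_nth (theta_fps \<tau>) (k - i)))
      has_field_derivative - (\<Sum>i=0..k. fps_nth (eisenstein_fps \<tau>) i * (c * fps_nth (theta_fps_D \<tau>) (k - i))
        + c * fps_nth (eisenstein_fps_D \<tau>) i * fps_nth (theta_fps \<tau>) (k - i))) (at \<tau>)"
    unfolding c_def
    by (intro DERIV_minus DERIV_sum DERIV_mult' has_field_derivative_eisenstein_fps_nth
        has_field_derivative_theta_fps_nth \<tau>)
  also have "(\<Sum>i=0..k. fps_nth (eisenstein_fps \<tau>) i * (c * fps_nth (theta_fps_D \<tau>) (k - i))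
        + c * fps_nth (eisenstein_fps_D \<tau>) i * fps_nth (theta_fps \<tau>) (k - i))
      = c * fps_nth (eisenstein_fps_D \<tau> * theta_fps \<tau> + eisenstein_fps \<tau> * theta_fps_D \<tau>) k"
    unfolding fps_add_nth fps_mult_nth distrib_left sum_distrib_left sum.distrib[symmetric]
    by (intro sum.cong refl) (simp add: mult_ac add_ac)
  finally have 1: "((\<lambda>\<tau>. - (\<Sum>i=0..k. fps_nth (eisenstein_fps \<tau>) i * fps_nth (theta_fps \<tau>) (k - i)))
      has_field_derivative
      - (c * fps_nth (eisenstein_fps_D \<tau> * theta_fps \<tau> + eisenstein_fps \<tau> * theta_fps_D \<tau>) k)) (at \<tau>)" .
  have "((\<lambda>\<tau>. of_nat (Suc k) * fps_nth (theta_fps \<tau>) (Suc k)) has_field_derivative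
      of_nat (Suc k) * (c * fps_nth (theta_fps_D \<tau>) (Suc k))) (at \<tau>)"
    unfolding c_def by (intro DERIV_cmult has_field_derivative_theta_fps_nth \<tau>)
  moreover have "of_nat (Suc k) * fps_nth (theta_fps x) (Suc k) =
      - (\<Sum>i=0..k. fps_nth (eisenstein_fps x) i * fps_nth (theta_fps x) (k - i))" if "x \<in> \<H>" for x
    using arg_cong[OF fps_deriv_theta[OF that], of "\<lambda>F. fps_nth F k"] by (simp add: fps_mult_nth)
  ultimately have "((\<lambda>\<tau>. - (\<Sum>i=0..k. fps_nth (eisenstein_fps \<tau>) i * fps_nth (theta_fps \<tau>) (k - i)))
      has_field_derivative of_nat (Suc k) * (c * fps_nth (theta_fps_D \<tau>) (Suc k))) (at \<tau>)"
    by (rule has_field_derivative_transform_within_open[OF _ open_upper_half_plane \<tau>])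
  from DERIV_unique[OF this 1]
  have "c * (of_nat (Suc k) * fps_nth (theta_fps_D \<tau>) (Suc k)) =
      c * (- fps_nth (eisenstein_fps_D \<tau> * theta_fps \<tau> + eisenstein_fps \<tau> * theta_fps_D \<tau>) k)"
    by (simp add: algebra_simps)
  then show "fps_nth (fps_deriv (theta_fps_D \<tau>)) k = fps_nth (- (eisenstein_fps_D \<tau> * theta_fps \<tau>
      + eisenstein_fps \<tau> * theta_fps_D \<tau>)) k"
    unfolding mult_left_cancel[OF c] by simp
qed

text \<open>
  The heat equation \<open>6 D T = T''\<close> becomes, for the logarithmic derivative \<open>W = - T' / T\<close>,
  the Burgers equation \<open>6 D W = (W' - W\<^sup>2)'\<close>.
\<close>

lemma eisenstein_fps_D_eq:
  assumes \<tau>: "\<tau> \<in> \<H>"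
  shows "6 * eisenstein_fps_D \<tau> = fps_deriv (fps_deriv (eisenstein_fps \<tau>) - eisenstein_fps \<tau> * eisenstein_fps \<tau>)"
proof -
  define T W V where "T = theta_fps \<tau>" and "W = eisenstein_fps \<tau>" and "V = eisenstein_fps_D \<tau>"
  note T' = fps_deriv_theta[OF \<tau>, folded T_def W_def]
  have 1: "6 * theta_fps_D \<tau> = - (fps_deriv W * T) + W * (W * T)"
    unfolding theta_fps_D_eq T_def[symmetric] T' by (simp add: T' algebra_simps)
  \<comment> \<open>The mixed derivative \<open>6 D T'\<close> is computed in two ways: by
    differentiating \<open>6 D T = (W^2 - W') T\<close> in \<open>u\<close>, and by applying
    \<open>D\<close> to \<open>T' = - W T\<close>. Cancelling \<open>T\<close> leaves the
    claim.\<close>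
  have "6 * fps_deriv (theta_fps_D \<tau>) = fps_deriv (6 * theta_fps_D \<tau>)"
    by simp
  also have "\<dots> = fps_deriv (- (fps_deriv W * T) + W * (W * T))"
    by (simp only: 1)
  also have "\<dots> = (- fps_deriv (fps_deriv W) + 3 * (W * fps_deriv W) - W * W * W) * T"
    by (simp add: T' algebra_simps)
  finally have 2: "6 * fps_deriv (theta_fps_D \<tau>) =
      (- fps_deriv (fps_deriv W) + 3 * (W * fps_deriv W) - W * W * W) * T" .
  have "6 * fps_deriv (theta_fps_D \<tau>) = - (6 * V * T + W * (6 * theta_fps_D \<tau>))"
    unfolding fps_deriv_theta_D[OF \<tau>] T_def W_def V_def by (simp add: algebra_simps)
  also have "\<dots> = (- 6 * V + W * fps_deriv W - W * W * W) * T"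
    unfolding 1 by (simp add: algebra_simps)
  finally have "(6 * V) * T = (fps_deriv (fps_deriv W - W * W)) * T"
    unfolding 2 by (simp add: algebra_simps)
  then show ?thesis
    using theta_fps_nonzero[OF \<tau>] by (simp add: T_def W_def V_def)
qed

lemma has_field_derivative_false_eisenstein:
  assumes "\<tau> \<in> \<H>" "k \<ge> 1"
  shows "(false_eisenstein k has_field_derivative 2 * of_real pi * \<i> *
     (fact (k - 1) * fps_nth (eisenstein_fps_D \<tau>) (k - 1))) (at \<tau>)"
proof -
  obtain l where k: "k = Suc l" using assms(2) by (cases k) auto
  have "((\<lambda>\<tau>. fact l * fps_nth (eisenstein_fps \<tau>) l) has_field_derivative
     fact l * (2 * of_real pi * \<i> * fps_nth (eisenstein_fps_D \<tau>) l)) (at \<tau>)"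
    by (intro DERIV_cmult has_field_derivative_eisenstein_fps_nth assms)
  from has_field_derivative_transform_within_open[OF this open_upper_half_plane assms(1)]
  have "(false_eisenstein k has_field_derivative
      fact l * (2 * of_real pi * \<i> * fps_nth (eisenstein_fps_D \<tau>) l)) (at \<tau>)"
    using false_eisenstein_Suc by (simp add: k)
  then show ?thesis by (simp add: k mult_ac)
qed

lemma qD_false_eisenstein:
  assumes \<tau>: "\<tau> \<in> \<H>" and k: "k \<ge> 1"
  shows "qD (false_eisenstein k) \<tau> =
     false_eisenstein (k + 2) \<tau> / 6
     - 1/6 * (\<Sum>d=0..k. of_nat (k choose d) * false_eisenstein (d + 1) \<tau> * false_eisenstein (k - d + 1) \<tau>)"
proof -
  obtain l where l: "k = Suc l" using k by (cases k) auto
  define W where "W = eisenstein_fps \<tau>"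
  have h: "false_eisenstein (Suc j) \<tau> = fact j * fps_nth W j" for j
    unfolding W_def by (rule false_eisenstein_Suc[OF \<tau>])
  have "6 * fps_nth (eisenstein_fps_D \<tau>) l = fps_nth (6 * eisenstein_fps_D \<tau>) l" by simp
  \<comment> \<open>Coefficient \<open>k - 1\<close> of the outer derivative supplies the factor
    \<open>k\<close> that turns \<open>fact (k - 1)\<close> into \<open>fact k\<close>.\<close>
  also have "\<dots> = of_nat k * (of_nat (Suc k) * fps_nth W (Suc k)
      - (\<Sum>d=0..k. fps_nth W d * fps_nth W (k - d)))"
    unfolding eisenstein_fps_D_eq[OF \<tau>]
    by (simp only: W_def l fps_deriv_nth fps_sub_nth fps_mult_nth Suc_eq_plus1)
  finally have 1: "fps_nth (eisenstein_fps_D \<tau>) l = of_nat k * (of_nat (Suc k) * fps_nth W (Suc k)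
      - (\<Sum>d=0..k. fps_nth W d * fps_nth W (k - d))) / 6"
    by (simp add: mult.commute)
  have "(\<Sum>d=0..k. of_nat (k choose d) * false_eisenstein (d + 1) \<tau> * false_eisenstein (k - d + 1) \<tau>)
      = (\<Sum>d=0..k. fact k * (fps_nth W d * fps_nth W (k - d)))"
    by (intro sum.cong refl) (simp add: h binomial_fact)
  then have 2: "(\<Sum>d=0..k. of_nat (k choose d) * false_eisenstein (d + 1) \<tau> * false_eisenstein (k - d + 1) \<tau>)
      = fact k * (\<Sum>d=0..k. fps_nth W d * fps_nth W (k - d))"
    by (simp add: sum_distrib_left)
  have "qD (false_eisenstein k) \<tau> = fact l * fps_nth (eisenstein_fps_D \<tau>) l"
    using DERIV_imp_deriv[OF has_field_derivative_false_eisenstein[OF \<tau> k]] \<tau>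
    by (simp add: qD_def l)
  also have "\<dots> = fact k * (of_nat (Suc k) * fps_nth W (Suc k)
      - (\<Sum>d=0..k. fps_nth W d * fps_nth W (k - d))) / 6"
    unfolding 1 by (simp add: l)
  also have "\<dots> = false_eisenstein (k + 2) \<tau> / 6
     - 1/6 * (\<Sum>d=0..k. of_nat (k choose d) * false_eisenstein (d + 1) \<tau> * false_eisenstein (k - d + 1) \<tau>)"
  proof -
    have h2: "false_eisenstein (k + 2) \<tau> = of_nat (Suc k) * fact k * fps_nth W (Suc k)"
      using h[of "Suc k"] by simp
    show ?thesis
      unfolding 2 h2 right_diff_distrib diff_divide_distrib by (simp add: mult_ac)
  qed
  finally show ?thesis .
qed

lemma false_eisenstein_2:
  assumes \<tau>: "\<tau> \<in> \<H>"
  shows "false_eisenstein 2 \<tau> / 6 - (false_eisenstein 1 \<tau>)\<^sup>2 / 6 = eisenstein_G 2 \<tau>"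
proof -
  define W T where "W = eisenstein_fps \<tau>" and "T = theta_fps \<tau>"
  have h: "false_eisenstein 1 \<tau> = fps_nth W 0" "false_eisenstein 2 \<tau> = fps_nth W 1"
    using false_eisenstein_Suc[OF \<tau>, of 0] false_eisenstein_Suc[OF \<tau>, of 1]
    by (simp_all add: W_def numeral_2_eq_2)
  note T' = fps_deriv_theta[OF \<tau>, folded T_def W_def]
  have "6 * theta_fps_D \<tau> = (W * W - fps_deriv W) * T"
    unfolding theta_fps_D_eq T_def[symmetric] T' by (simp add: T' algebra_simps)
  from arg_cong[OF this, of "\<lambda>F. fps_nth F 0"]
  have 1: "6 * fps_nth (theta_fps_D \<tau>) 0 = ((false_eisenstein 1 \<tau>)\<^sup>2 - false_eisenstein 2 \<tau>) * dedekind_eta \<tau>"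
    using theta_fps_nth_0[OF \<tau>] unfolding h by (simp add: T_def power2_eq_square)
  have "(dedekind_eta has_field_derivative 2 * of_real pi * \<i> * fps_nth (theta_fps_D \<tau>) 0) (at \<tau>)"
    by (rule has_field_derivative_transform_within_open[OF has_field_derivative_theta_fps_nth[OF \<tau>]
          open_upper_half_plane \<tau>]) (rule theta_fps_nth_0)
  from DERIV_unique[OF this has_field_derivative_dedekind_eta[OF \<tau>]]
  have "(2 * of_real pi * \<i>) * fps_nth (theta_fps_D \<tau>) 0
      = (2 * of_real pi * \<i>) * (- eisenstein_G 2 \<tau> * dedekind_eta \<tau>)"
    by (simp only: mult_minus_left mult_minus_right mult.assoc)
  moreover have "2 * of_real pi * \<i> \<noteq> (0 :: complex)" by simp
  ultimately have "fps_nth (theta_fps_D \<tau>) 0 = - eisenstein_G 2 \<tau> * dedekind_eta \<tau>"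
    using mult_left_cancel by blast
  with 1 have "6 * (- eisenstein_G 2 \<tau>) * dedekind_eta \<tau>
      = ((false_eisenstein 1 \<tau>)\<^sup>2 - false_eisenstein 2 \<tau>) * dedekind_eta \<tau>"
    by (simp only: mult.assoc)
  then have "6 * (- eisenstein_G 2 \<tau>) = (false_eisenstein 1 \<tau>)\<^sup>2 - false_eisenstein 2 \<tau>"
    using dedekind_eta_nonzero[OF \<tau>] mult_right_cancel by blast
  then have "6 * eisenstein_G 2 \<tau> = false_eisenstein 2 \<tau> - (false_eisenstein 1 \<tau>)\<^sup>2"
    by algebra
  then have "eisenstein_G 2 \<tau> = (false_eisenstein 2 \<tau> - (false_eisenstein 1 \<tau>)\<^sup>2) / 6"
    by (simp add: mult.commute)
  then show ?thesis by (simp only: diff_divide_distrib)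
qed

subsection \<open>The algebras\<close>

declare restrict_apply [simp del] restrict_apply' [simp]

lemma fun_algebra_restrict:
  assumes "f \<in> fun_algebra X"
  shows "restrict f \<H> = f"
  using assms by cases auto

lemma fun_algebra_cong:
  assumes "\<And>\<tau>. \<tau> \<in> \<H> \<Longrightarrow> f \<tau> = g \<tau>"
  shows "restrict f \<H> \<in> fun_algebra X \<longleftrightarrow> restrict g \<H> \<in> fun_algebra X"
proof -
  have "restrict f \<H> = restrict g \<H>"
    using assms by (rule restrict_ext)
  then show ?thesis by simp
qed

text \<open>Unlike the inductive rules, these closure rules accept functions that are not
  \<open>undefined\<close> outside \<H>, so a polynomial expression can be built up without
  restricting every subterm.\<close>

lemma fun_algebra_add:
  assumes "restrict f \<H> \<in> fun_algebra X" "restrict g \<H> \<in> fun_algebra X"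
  shows "(\<lambda>\<tau>\<in>\<H>. f \<tau> + g \<tau>) \<in> fun_algebra X"
  using fun_algebra.add[OF assms] by (rule fun_algebra_cong[THEN iffD1, rotated]) simp

lemma fun_algebra_mult:
  assumes "restrict f \<H> \<in> fun_algebra X" "restrict g \<H> \<in> fun_algebra X"
  shows "(\<lambda>\<tau>\<in>\<H>. f \<tau> * g \<tau>) \<in> fun_algebra X"
  using fun_algebra.mult[OF assms] by (rule fun_algebra_cong[THEN iffD1, rotated]) simp

lemma fun_algebra_cmult:
  assumes "restrict f \<H> \<in> fun_algebra X"
  shows "(\<lambda>\<tau>\<in>\<H>. c * f \<tau>) \<in> fun_algebra X"
  by (rule fun_algebra_mult[OF fun_algebra.const assms])

lemma fun_algebra_diff:
  assumes "restrict f \<H> \<in> fun_algebra X" "restrict g \<H> \<in> fun_algebra X"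
  shows "(\<lambda>\<tau>\<in>\<H>. f \<tau> - g \<tau>) \<in> fun_algebra X"
  using fun_algebra_add[OF assms(1) fun_algebra_cmult[OF assms(2), of "-1"]] by simp

lemma fun_algebra_power:
  assumes "restrict f \<H> \<in> fun_algebra X"
  shows "(\<lambda>\<tau>\<in>\<H>. f \<tau> ^ n) \<in> fun_algebra X"
proof (induction n)
  case 0
  show ?case unfolding power_0 by (rule fun_algebra.const)
next
  case (Suc n)
  show ?case unfolding power_Suc by (rule fun_algebra_mult[OF assms Suc])
qed

lemma fun_algebra_sum:
  assumes "\<And>i. i \<in> A \<Longrightarrow> restrict (f i) \<H> \<in> fun_algebra X"
  shows "(\<lambda>\<tau>\<in>\<H>. \<Sum>i\<in>A. f i \<tau>) \<in> fun_algebra X"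
  using assms
proof (induction A rule: infinite_finite_induct)
  case (infinite A)
  show ?case unfolding sum.infinite[OF infinite(1)] by (rule fun_algebra.const)
next
  case empty
  show ?case unfolding sum.empty by (rule fun_algebra.const)
next
  case (insert i A)
  have "restrict (f i) \<H> \<in> fun_algebra X"
    by (rule insert.prems) simp
  moreover have "(\<lambda>\<tau>\<in>\<H>. \<Sum>i\<in>A. f i \<tau>) \<in> fun_algebra X"
    by (rule insert.IH, rule insert.prems) simp
  ultimately show ?case
    unfolding sum.insert[OF insert(1,2)] by (rule fun_algebra_add)
qed

lemmas fun_algebra_intros =
  fun_algebra.const fun_algebra_add fun_algebra_mult fun_algebra_cmult fun_algebra_diff
  fun_algebra_power fun_algebra_sum

lemma fun_algebra_subset:
  assumes "\<And>f. f \<in> X \<Longrightarrow> restrict f \<H> \<in> fun_algebra Y"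
  shows "fun_algebra X \<subseteq> fun_algebra Y"
proof
  fix f assume "f \<in> fun_algebra X"
  then show "f \<in> fun_algebra Y"
    by induction (auto intro: fun_algebra.intros assms)
qed

lemma fun_algebra_mono: "X \<subseteq> Y \<Longrightarrow> fun_algebra X \<subseteq> fun_algebra Y"
  by (rule fun_algebra_subset) (auto intro: fun_algebra.gen)

lemma has_field_derivative_restrict:
  assumes "(f has_field_derivative d) (at \<tau>)" "\<tau> \<in> \<H>"
  shows "(restrict f \<H> has_field_derivative d) (at \<tau>)"
  by (rule has_field_derivative_transform_within_open[OF assms(1) open_upper_half_plane assms(2)]) simp

text \<open>By the Leibniz rule it suffices to know \<open>D\<close> on generators. Source and
  target have separate generating sets because \<open>D\<close> may lead out of
  \<open>fun_algebra X\<close>; differentiability has to be carried through the induction for the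
  rules of differentiation to apply.\<close>

lemma fun_algebra_deriv:
  assumes X: "\<And>f. f \<in> X \<Longrightarrow> restrict f \<H> \<in> fun_algebra Y \<and> qD f \<in> fun_algebra Y \<and>
      (\<forall>\<tau>\<in>\<H>. f field_differentiable (at \<tau>))"
    and f: "f \<in> fun_algebra X"
  shows "(\<forall>\<tau>\<in>\<H>. f field_differentiable (at \<tau>)) \<and> qD f \<in> fun_algebra Y"
  using f
proof induction
  case (const c)
  have d: "((\<lambda>\<tau>\<in>\<H>. c) has_field_derivative 0) (at \<tau>)" if "\<tau> \<in> \<H>" for \<tau>
    by (rule has_field_derivative_restrict[OF DERIV_const that])
  have "qD (\<lambda>\<tau>\<in>\<H>. c) = (\<lambda>\<tau>\<in>\<H>. 0)"
    unfolding qD_def by (intro restrict_ext) (simp add: DERIV_imp_deriv[OF d])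
  then show ?case using d fun_algebra.const[of 0 Y] by (auto simp: field_differentiable_def)
next
  case (gen f)
  have d: "(restrict f \<H> has_field_derivative deriv f \<tau>) (at \<tau>)" if "\<tau> \<in> \<H>" for \<tau>
    using X[OF gen] that by (intro has_field_derivative_restrict field_differentiable_derivI) auto
  have "qD (restrict f \<H>) = qD f"
    unfolding qD_def by (intro restrict_ext) (simp add: DERIV_imp_deriv[OF d])
  then show ?case using d X[OF gen] by (auto simp: field_differentiable_def)
next
  case (add f g)
  have d: "((\<lambda>\<tau>\<in>\<H>. f \<tau> + g \<tau>) has_field_derivative deriv f \<tau> + deriv g \<tau>) (at \<tau>)"
    if "\<tau> \<in> \<H>" for \<tau>
    using add.IH that
    by (intro has_field_derivative_restrict DERIV_add field_differentiable_derivI) auto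
  have "qD (\<lambda>\<tau>\<in>\<H>. f \<tau> + g \<tau>) = (\<lambda>\<tau>\<in>\<H>. qD f \<tau> + qD g \<tau>)"
    unfolding qD_def by (intro restrict_ext) (simp add: DERIV_imp_deriv[OF d] add_divide_distrib)
  then show ?case using d add.IH fun_algebra.add by (auto simp: field_differentiable_def)
next
  case (mult f g)
  have XY: "fun_algebra X \<subseteq> fun_algebra Y" using X by (intro fun_algebra_subset) auto
  have d: "((\<lambda>\<tau>\<in>\<H>. f \<tau> * g \<tau>) has_field_derivative f \<tau> * deriv g \<tau> + deriv f \<tau> * g \<tau>) (at \<tau>)"
    if "\<tau> \<in> \<H>" for \<tau>
    using mult.IH that
    by (intro has_field_derivative_restrict DERIV_mult' field_differentiable_derivI) auto
  have "qD (\<lambda>\<tau>\<in>\<H>. f \<tau> * g \<tau>) = (\<lambda>\<tau>\<in>\<H>. (\<lambda>\<tau>\<in>\<H>. f \<tau> * qD g \<tau>) \<tau> + (\<lambda>\<tau>\<in>\<H>. qD f \<tau> * g \<tau>) \<tau>)"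
    unfolding qD_def by (intro restrict_ext) (simp add: DERIV_imp_deriv[OF d] add_divide_distrib)
  moreover have "\<dots> \<in> fun_algebra Y"
    using mult XY by (intro fun_algebra.add fun_algebra.mult) auto
  ultimately show ?case using d by (auto simp: field_differentiable_def)
qed

section \<open>Quasimodular forms under \<open>D\<close>\<close>

lemma has_field_derivative_eisenstein_G:
  assumes "\<tau> \<in> \<H>"
  shows "(eisenstein_G k has_field_derivative
    2 * of_real pi * \<i> * lambert_deriv (k - 1) (qpow 1 \<tau>)) (at \<tau>)"
proof -
  have "((\<lambda>\<tau>. - bernoulli k / (2 * of_nat k) + lambert_sum (k - 1) (qpow 1 \<tau>)) has_field_derivative
      0 + 2 * of_real pi * \<i> * lambert_deriv (k - 1) (qpow 1 \<tau>)) (at \<tau>)"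
    by (intro DERIV_add DERIV_const has_field_derivative_lambert_sum_qpow assms)
  from has_field_derivative_transform_within_open[OF this open_upper_half_plane assms
      eisenstein_G_eq[symmetric]]
  show ?thesis by (simp only: add_0_left)
qed

lemma qD_eisenstein_G: "qD (eisenstein_G k) = (\<lambda>\<tau>\<in>\<H>. lambert_deriv (k - 1) (qpow 1 \<tau>))"
  unfolding qD_def
  by (intro restrict_ext) (simp add: DERIV_imp_deriv[OF has_field_derivative_eisenstein_G])

text \<open>The two functions differ by a constant, and constants belong to every algebra;
  membership of Eisenstein series can thus be decided on Lambert sums.\<close>

lemma eisenstein_G_in_fun_algebra_iff:
  "restrict (eisenstein_G k) \<H> \<in> fun_algebra X \<longleftrightarrow>
   (\<lambda>\<tau>\<in>\<H>. lambert_sum (k - 1) (qpow 1 \<tau>)) \<in> fun_algebra X"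
proof
  assume "restrict (eisenstein_G k) \<H> \<in> fun_algebra X"
  then have "(\<lambda>\<tau>\<in>\<H>. eisenstein_G k \<tau> - - bernoulli k / (2 * of_nat k)) \<in> fun_algebra X"
    by (intro fun_algebra_intros)
  then show "(\<lambda>\<tau>\<in>\<H>. lambert_sum (k - 1) (qpow 1 \<tau>)) \<in> fun_algebra X"
    by (rule fun_algebra_cong[THEN iffD1, rotated]) (simp add: eisenstein_G_eq)
next
  assume "(\<lambda>\<tau>\<in>\<H>. lambert_sum (k - 1) (qpow 1 \<tau>)) \<in> fun_algebra X"
  then have "(\<lambda>\<tau>\<in>\<H>. - bernoulli k / (2 * of_nat k) + lambert_sum (k - 1) (qpow 1 \<tau>)) \<in> fun_algebra X"
    by (intro fun_algebra_intros)
  then show "restrict (eisenstein_G k) \<H> \<in> fun_algebra X"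
    by (rule fun_algebra_cong[THEN iffD1, rotated]) (simp add: eisenstein_G_eq)
qed

lemma quasimodular_deriv:
  assumes "f \<in> quasimodular_forms"
  shows "(\<forall>\<tau>\<in>\<H>. f field_differentiable (at \<tau>)) \<and> qD f \<in> quasimodular_forms"
proof -
  define X where "X = {eisenstein_G 2, eisenstein_G 4, eisenstein_G 6}"
  define S where "S = (\<lambda>j \<tau>. lambert_sum j (qpow 1 \<tau>))"
  define Q where "Q = (\<lambda>j \<tau>. lambert_deriv j (qpow 1 \<tau>))"
  have S: "restrict (S 1) \<H> \<in> fun_algebra X" "restrict (S 3) \<H> \<in> fun_algebra X"
    "restrict (S 5) \<H> \<in> fun_algebra X"
    using eisenstein_G_in_fun_algebra_iff[of 2 X] eisenstein_G_in_fun_algebra_iff[of 4 X]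
      eisenstein_G_in_fun_algebra_iff[of 6 X]
    by (auto simp: S_def X_def intro: fun_algebra.gen)
  have "(\<lambda>\<tau>\<in>\<H>. 1/6 * (5 * S 3 \<tau> + S 1 \<tau> - 12 * S 1 \<tau> ^ 2)) \<in> fun_algebra X"
    by (intro fun_algebra_intros S)
  then have Q1: "restrict (Q 1) \<H> \<in> fun_algebra X"
  proof (rule fun_algebra_cong[THEN iffD1, rotated])
    fix \<tau> assume "\<tau> \<in> \<H>"
    from lambert_sum_1_square[OF norm_qpow_1[OF this]]
    show "1/6 * (5 * S 3 \<tau> + S 1 \<tau> - 12 * S 1 \<tau> ^ 2) = Q 1 \<tau>"
      by (simp add: S_def Q_def)
  qed
  have "(\<lambda>\<tau>\<in>\<H>. 1/30 * (21 * S 5 \<tau> + 10 * S 3 \<tau> - S 1 \<tau> - 240 * (S 1 \<tau> * S 3 \<tau>))) \<in> fun_algebra X"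
    by (intro fun_algebra_intros S)
  then have Q3: "restrict (Q 3) \<H> \<in> fun_algebra X"
  proof (rule fun_algebra_cong[THEN iffD1, rotated])
    fix \<tau> assume "\<tau> \<in> \<H>"
    from lambert_sum_1_3[OF norm_qpow_1[OF this]]
    show "1/30 * (21 * S 5 \<tau> + 10 * S 3 \<tau> - S 1 \<tau> - 240 * (S 1 \<tau> * S 3 \<tau>)) = Q 3 \<tau>"
      by (simp add: S_def Q_def mult.assoc)
  qed
  \<comment> \<open>This is \<open>lambert_sum_1_5\<close> solved for the derivative, with
    \<open>S_7\<close> replaced by \<open>120 S_3^2 + S_3\<close>.\<close>
  have "(\<lambda>\<tau>\<in>\<H>. 1/42 * (27 * (120 * S 3 \<tau> ^ 2 + S 3 \<tau>) + 21 * S 5 \<tau> - 7 * S 3 \<tau> + S 1 \<tau>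
      - 504 * (S 1 \<tau> * S 5 \<tau>) - 840 * S 3 \<tau> ^ 2)) \<in> fun_algebra X"
    by (intro fun_algebra_intros S)
  then have Q5: "restrict (Q 5) \<H> \<in> fun_algebra X"
  proof (rule fun_algebra_cong[THEN iffD1, rotated])
    fix \<tau> assume \<tau>: "\<tau> \<in> \<H>"
    from lambert_sum_3_square[OF norm_qpow_1[OF \<tau>]]
    have "120 * S 3 \<tau> ^ 2 + S 3 \<tau> = S 7 \<tau>" by (simp add: S_def)
    with lambert_sum_1_5[OF norm_qpow_1[OF \<tau>]]
    show "1/42 * (27 * (120 * S 3 \<tau> ^ 2 + S 3 \<tau>) + 21 * S 5 \<tau> - 7 * S 3 \<tau> + S 1 \<tau>
      - 504 * (S 1 \<tau> * S 5 \<tau>) - 840 * S 3 \<tau> ^ 2) = Q 5 \<tau>"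
      by (simp add: S_def Q_def mult.assoc) algebra
  qed
  have "restrict g \<H> \<in> fun_algebra X \<and> qD g \<in> fun_algebra X \<and>
      (\<forall>\<tau>\<in>\<H>. g field_differentiable (at \<tau>))" if "g \<in> X" for g
  proof -
    have "\<exists>k. g = eisenstein_G k \<and> k \<in> {2, 4, 6}" using that by (auto simp: X_def)
    then obtain k where k: "g = eisenstein_G k" "k \<in> {2, 4, 6}" by blast
    have "qD g = restrict (Q (k - 1)) \<H>" unfolding k(1) qD_eisenstein_G Q_def ..
    then have "qD g \<in> fun_algebra X" using k(2) Q1 Q3 Q5 by auto
    moreover have "\<forall>\<tau>\<in>\<H>. g field_differentiable (at \<tau>)"
      unfolding k(1) using has_field_derivative_eisenstein_G by (auto simp: field_differentiable_def)
    ultimately show ?thesis using fun_algebra.gen[OF that] by blast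
  qed
  from fun_algebra_deriv[OF this] show ?thesis
    using assms unfolding quasimodular_forms_def X_def by blast
qed

section \<open>The structure of the algebra of false Eisenstein series\<close>

definition conv_product :: "nat \<Rightarrow> complex \<Rightarrow> complex" where
  "conv_product k \<tau> =
     (\<Sum>d=0..k. of_nat (k choose d) * false_eisenstein (d + 1) \<tau> * false_eisenstein (k - d + 1) \<tau>)"

lemma false_eisenstein_field_differentiable:
  assumes "\<tau> \<in> \<H>" "k \<ge> 1"
  shows "false_eisenstein k field_differentiable (at \<tau>)"
  using has_field_derivative_false_eisenstein[OF assms] by (auto simp: field_differentiable_def)

text \<open>The formula for \<open>D h_k\<close> is linear in \<open>h_(k+2)\<close> with
  coefficient \<open>1/6\<close>, and all other indices are at most \<open>k + 1\<close>. One
  direction gives closure under \<open>D\<close>, the other obtains \<open>h_(k+2)\<close> from a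
  derivative.\<close>

lemma qD_false_eisenstein_in_iff:
  assumes k: "k \<ge> 1"
    and c: "\<And>d. d \<le> k \<Longrightarrow> restrict (false_eisenstein (d + 1)) \<H> \<in> fun_algebra X"
  shows "qD (false_eisenstein k) \<in> fun_algebra X \<longleftrightarrow>
    restrict (false_eisenstein (k + 2)) \<H> \<in> fun_algebra X"
proof -
  have C: "restrict (conv_product k) \<H> \<in> fun_algebra X"
    unfolding conv_product_def by (intro fun_algebra_intros c) auto
  have r: "restrict (qD (false_eisenstein k)) \<H> = qD (false_eisenstein k)"
    by (simp add: qD_def)
  have e: "qD (false_eisenstein k) \<tau> = 1/6 * false_eisenstein (k + 2) \<tau> - 1/6 * conv_product k \<tau>"
    if "\<tau> \<in> \<H>" for \<tau>
    using qD_false_eisenstein[OF that k] by (simp add: conv_product_def)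
  show ?thesis
  proof
    assume "restrict (false_eisenstein (k + 2)) \<H> \<in> fun_algebra X"
    then have "(\<lambda>\<tau>\<in>\<H>. 1/6 * false_eisenstein (k + 2) \<tau> - 1/6 * conv_product k \<tau>) \<in> fun_algebra X"
      by (intro fun_algebra_intros C)
    then show "qD (false_eisenstein k) \<in> fun_algebra X"
      by (subst r[symmetric], rule fun_algebra_cong[THEN iffD1, rotated]) (simp add: e)
  next
    assume "qD (false_eisenstein k) \<in> fun_algebra X"
    then have "restrict (qD (false_eisenstein k)) \<H> \<in> fun_algebra X" by (simp only: r)
    then have "(\<lambda>\<tau>\<in>\<H>. 6 * qD (false_eisenstein k) \<tau> + conv_product k \<tau>) \<in> fun_algebra X"
      by (intro fun_algebra_intros C)
    then show "restrict (false_eisenstein (k + 2)) \<H> \<in> fun_algebra X"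
      by (rule fun_algebra_cong[THEN iffD1, rotated]) (simp add: e)
  qed
qed

lemma false_eisenstein_in_algebra:
  "k \<ge> 1 \<Longrightarrow> restrict (false_eisenstein k) \<H> \<in> false_eisenstein_algebra"
  unfolding false_eisenstein_algebra_def by (auto intro: fun_algebra.gen)

lemma false_eisenstein_algebra_deriv:
  assumes "f \<in> false_eisenstein_algebra"
  shows "(\<forall>\<tau>\<in>\<H>. f field_differentiable (at \<tau>)) \<and> qD f \<in> false_eisenstein_algebra"
proof -
  have "restrict g \<H> \<in> false_eisenstein_algebra \<and> qD g \<in> false_eisenstein_algebra \<and>
      (\<forall>\<tau>\<in>\<H>. g field_differentiable (at \<tau>))"
    if gen: "g \<in> {false_eisenstein k | k. k \<ge> 1}" for g
  proof -
    obtain k where k: "g = false_eisenstein k" "k \<ge> 1" using gen by blast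
    have "qD g \<in> false_eisenstein_algebra"
      unfolding k(1) false_eisenstein_algebra_def
      by (rule qD_false_eisenstein_in_iff[OF k(2), THEN iffD2];
          rule false_eisenstein_in_algebra[unfolded false_eisenstein_algebra_def]; simp)
    then show ?thesis
      using false_eisenstein_in_algebra[OF k(2)] false_eisenstein_field_differentiable[OF _ k(2)]
      by (auto simp: k(1))
  qed
  from fun_algebra_deriv[OF this[unfolded false_eisenstein_algebra_def]] show ?thesis
    using assms unfolding false_eisenstein_algebra_def by blast
qed

lemma quasimodular_forms_subset: "quasimodular_forms \<subseteq> false_eisenstein_algebra"
proof -
  define X where "X = {false_eisenstein k | k. k \<ge> 1}"
  define S where "S = (\<lambda>j \<tau>. lambert_sum j (qpow 1 \<tau>))"
  define Q where "Q = (\<lambda>j \<tau>. lambert_deriv j (qpow 1 \<tau>))"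
  have H: "false_eisenstein_algebra = fun_algebra X"
    by (simp add: false_eisenstein_algebra_def X_def)
  have D: "restrict (Q j) \<H> \<in> fun_algebra X" if "restrict (S j) \<H> \<in> fun_algebra X" for j
  proof -
    have "qD (restrict (S j) \<H>) = restrict (Q j) \<H>"
      unfolding qD_def Q_def S_def
      by (intro restrict_ext)
         (simp add: DERIV_imp_deriv[OF has_field_derivative_restrict[OF has_field_derivative_lambert_sum_qpow]])
    then show ?thesis using false_eisenstein_algebra_deriv[unfolded H, OF that] by simp
  qed
  have h: "restrict (false_eisenstein 1) \<H> \<in> fun_algebra X" "restrict (false_eisenstein 2) \<H> \<in> fun_algebra X"
    using false_eisenstein_in_algebra by (auto simp: H)
  have "(\<lambda>\<tau>\<in>\<H>. 1/6 * false_eisenstein 2 \<tau> - 1/6 * false_eisenstein 1 \<tau> ^ 2) \<in> fun_algebra X"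
    by (intro fun_algebra_intros h)
  then have G2: "restrict (eisenstein_G 2) \<H> \<in> fun_algebra X"
    by (rule fun_algebra_cong[THEN iffD1, rotated]) (simp add: false_eisenstein_2[symmetric])
  then have S1: "restrict (S 1) \<H> \<in> fun_algebra X"
    unfolding eisenstein_G_in_fun_algebra_iff by (simp add: S_def)
  \<comment> \<open>Ramanujan's relation is now read in the other direction, solved for the Lambert
    sum of higher index; the derivative in it is available because the algebra is closed under
    \<open>D\<close>.\<close>
  have "(\<lambda>\<tau>\<in>\<H>. 1/5 * (12 * S 1 \<tau> ^ 2 - S 1 \<tau> + 6 * Q 1 \<tau>)) \<in> fun_algebra X"
    by (intro fun_algebra_intros S1 D)
  then have S3: "restrict (S 3) \<H> \<in> fun_algebra X"
  proof (rule fun_algebra_cong[THEN iffD1, rotated])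
    fix \<tau> assume "\<tau> \<in> \<H>"
    from lambert_sum_1_square[OF norm_qpow_1[OF this]]
    show "1/5 * (12 * S 1 \<tau> ^ 2 - S 1 \<tau> + 6 * Q 1 \<tau>) = S 3 \<tau>"
      by (simp add: S_def Q_def)
  qed
  have "(\<lambda>\<tau>\<in>\<H>. 1/21 * (240 * (S 1 \<tau> * S 3 \<tau>) - 10 * S 3 \<tau> + S 1 \<tau> + 30 * Q 3 \<tau>)) \<in> fun_algebra X"
    by (intro fun_algebra_intros S1 S3 D)
  then have S5: "restrict (S 5) \<H> \<in> fun_algebra X"
  proof (rule fun_algebra_cong[THEN iffD1, rotated])
    fix \<tau> assume "\<tau> \<in> \<H>"
    from lambert_sum_1_3[OF norm_qpow_1[OF this]]
    show "1/21 * (240 * (S 1 \<tau> * S 3 \<tau>) - 10 * S 3 \<tau> + S 1 \<tau> + 30 * Q 3 \<tau>) = S 5 \<tau>"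
      by (simp add: S_def Q_def mult.assoc)
  qed
  have "restrict (eisenstein_G k) \<H> \<in> fun_algebra X" if "k \<in> {2, 4, 6}" for k
    using that S1 S3 S5 unfolding eisenstein_G_in_fun_algebra_iff by (auto simp: S_def)
  then show ?thesis
    unfolding quasimodular_forms_def H by (intro fun_algebra_subset) auto
qed

text \<open>
  \<open>D\<close> raises the index of the \<open>h\<^sub>k\<close> involved, so the induction has to keep track of which odd
  indices are used.
\<close>

lemma even_false_eisenstein:
  assumes "1 \<le> i" "i \<le> j"
  shows "restrict (false_eisenstein (2 * i)) \<H> \<in>
    fun_algebra (quasimodular_forms \<union> {false_eisenstein k | k. odd k \<and> k < 2 * j})"
  using assms
proof (induction j arbitrary: i)
  case (Suc j)
  define X where "X = (\<lambda>j. quasimodular_forms \<union> {false_eisenstein k | k. odd k \<and> k < 2 * j})"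
  have sub: "fun_algebra (X j) \<subseteq> fun_algebra (X (Suc j))"
    by (rule fun_algebra_mono) (force simp: X_def)
  have odd: "restrict (false_eisenstein k) \<H> \<in> fun_algebra (X (Suc j))" if "odd k" "k < 2 * Suc j" for k
    using that by (intro fun_algebra.gen) (auto simp: X_def)
  have even: "restrict (false_eisenstein (2 * i)) \<H> \<in> fun_algebra (X j)" if "1 \<le> i" "i \<le> j" for i
    using Suc.IH[OF that] by (simp add: X_def)
  have small: "restrict (false_eisenstein k) \<H> \<in> fun_algebra (X (Suc j))" if "1 \<le> k" "k \<le> 2 * j + 1" for k
  proof (cases "even k")
    case True
    then obtain i where "k = 2 * i" by (elim evenE)
    then show ?thesis using even[of i] sub that by auto
  next
    case False
    then show ?thesis using odd[of k] that by simp
  qed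
  have qm: "restrict f \<H> \<in> fun_algebra (X n)" if "f \<in> quasimodular_forms" for f n
    using that by (intro fun_algebra.gen) (auto simp: X_def)
  show ?case
  proof (cases "i \<le> j")
    case True
    then show ?thesis using even[OF Suc.prems(1) True] sub by (auto simp: X_def)
  next
    case False
    then have i: "i = Suc j" using Suc.prems by simp
    have "restrict (false_eisenstein (2 * Suc j)) \<H> \<in> fun_algebra (X (Suc j))"
    proof (cases "j = 0")
      case True
      \<comment> \<open>The induction starts with \<open>h_2 = 6 G_2 + h_1^2\<close>; the formula
        for \<open>D h_k\<close> cannot yield \<open>h_2\<close>, as there is no
        \<open>h_0\<close>.\<close>
      have "restrict (eisenstein_G 2) \<H> \<in> quasimodular_forms"
        by (auto simp: quasimodular_forms_def intro: fun_algebra.gen)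
      then have "restrict (eisenstein_G 2) \<H> \<in> fun_algebra (X (Suc j))"
        using qm[of "restrict (eisenstein_G 2) \<H>"] by simp
      moreover have "restrict (false_eisenstein 1) \<H> \<in> fun_algebra (X (Suc j))"
        by (rule odd) auto
      ultimately have "(\<lambda>\<tau>\<in>\<H>. 6 * eisenstein_G 2 \<tau> + false_eisenstein 1 \<tau> ^ 2) \<in> fun_algebra (X (Suc j))"
        by (intro fun_algebra_intros)
      then have "restrict (false_eisenstein 2) \<H> \<in> fun_algebra (X (Suc j))"
        by (rule fun_algebra_cong[THEN iffD1, rotated]) (simp add: false_eisenstein_2[symmetric])
      then show ?thesis using True by simp
    next
      case False
      \<comment> \<open>For odd \<open>k < 2 j\<close> the derivative of \<open>h_k\<close> involves
        \<open>h_(k+2)\<close>, whose odd index is below \<open>2 (j + 1)\<close>, and indices up to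
        \<open>k + 1 \<le> 2 j\<close>, covered by the induction hypothesis. So \<open>D\<close>
        maps level \<open>j\<close> into level \<open>j + 1\<close>.\<close>
      have gens: "restrict f \<H> \<in> fun_algebra (X (Suc j)) \<and> qD f \<in> fun_algebra (X (Suc j)) \<and>
          (\<forall>\<tau>\<in>\<H>. f field_differentiable (at \<tau>))" if f: "f \<in> X j" for f
      proof (cases "f \<in> quasimodular_forms")
        case True
        have "restrict (qD f) \<H> \<in> fun_algebra (X (Suc j))"
          using quasimodular_deriv[OF True] qm by blast
        then show ?thesis using quasimodular_deriv[OF True] qm[OF True] by (simp add: qD_def)
      next
        case False
        then obtain k where k: "f = false_eisenstein k" "odd k" "k < 2 * j"
          using f by (auto simp: X_def)
        have k1: "k \<ge> 1" using k(2) by (cases k) auto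
        have "restrict (false_eisenstein (k + 2)) \<H> \<in> fun_algebra (X (Suc j))"
          using k by (intro odd) auto
        then have "qD f \<in> fun_algebra (X (Suc j))"
          unfolding k(1) using k(3) by (subst qD_false_eisenstein_in_iff[OF k1]) (auto intro!: small)
        then show ?thesis
          using small[of k] k k1 false_eisenstein_field_differentiable[OF _ k1] by auto
      qed
      have "restrict (false_eisenstein (2 * j)) \<H> \<in> fun_algebra (X j)"
        using even[of j] False by simp
      from fun_algebra_deriv[OF gens this]
      have "qD (restrict (false_eisenstein (2 * j)) \<H>) \<in> fun_algebra (X (Suc j))" by blast
      also have "qD (restrict (false_eisenstein (2 * j)) \<H>) = qD (false_eisenstein (2 * j))"
        unfolding qD_def using False
        by (intro restrict_ext)
           (simp add: DERIV_imp_deriv[OF has_field_derivative_restrict[OF field_differentiable_derivI]]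
             false_eisenstein_field_differentiable)
      \<comment> \<open>The formula for \<open>D h_(2j)\<close> is solved for
        \<open>h_(2j+2)\<close>; its quadratic part has indices at most
        \<open>2 j + 1\<close>.\<close>
      finally have "restrict (false_eisenstein (2 * j + 2)) \<H> \<in> fun_algebra (X (Suc j))"
        using False by (subst qD_false_eisenstein_in_iff[symmetric]) (auto intro!: small)
      then show ?thesis by simp
    qed
    then show ?thesis by (simp add: i X_def)
  qed
qed simp

lemma false_eisenstein_algebra_eq:
  "false_eisenstein_algebra = fun_algebra (quasimodular_forms \<union> {false_eisenstein k | k. odd k})"
proof
  show "fun_algebra (quasimodular_forms \<union> {false_eisenstein k | k. odd k}) \<subseteq> false_eisenstein_algebra"
    unfolding false_eisenstein_algebra_def
  proof (rule fun_algebra_subset)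
    fix f assume "f \<in> quasimodular_forms \<union> {false_eisenstein k | k. odd k}"
    then consider "f \<in> quasimodular_forms" | k where "f = false_eisenstein k" "odd k" by blast
    then show "restrict f \<H> \<in> fun_algebra {false_eisenstein k | k. k \<ge> 1}"
    proof cases
      case 1
      then have "f \<in> false_eisenstein_algebra" using quasimodular_forms_subset by blast
      then show ?thesis
        using fun_algebra_restrict unfolding false_eisenstein_algebra_def by fastforce
    next
      case (2 k)
      then have "k \<ge> 1" by (cases k) auto
      then show ?thesis
        using false_eisenstein_in_algebra[of k] by (simp add: 2 false_eisenstein_algebra_def)
    qed
  qed
  show "false_eisenstein_algebra \<subseteq> fun_algebra (quasimodular_forms \<union> {false_eisenstein k | k. odd k})"
    unfolding false_eisenstein_algebra_def
  proof (rule fun_algebra_subset)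
    fix f assume "f \<in> {false_eisenstein k | k. k \<ge> 1}"
    then obtain k where k: "f = false_eisenstein k" "k \<ge> 1" by blast
    show "restrict f \<H> \<in> fun_algebra (quasimodular_forms \<union> {false_eisenstein k | k. odd k})"
    proof (cases "even k")
      case True
      then obtain i where i: "k = 2 * i" by (elim evenE)
      have "fun_algebra (quasimodular_forms \<union> {false_eisenstein k | k. odd k \<and> k < 2 * i})
          \<subseteq> fun_algebra (quasimodular_forms \<union> {false_eisenstein k | k. odd k})"
        by (rule fun_algebra_mono) auto
      then show ?thesis using even_false_eisenstein[of i i] k i by auto
    next
      case False
      then show ?thesis using k by (intro fun_algebra.gen) auto
    qed
  qed
qed

theorem theorem1p4:
  shows "(\<forall>f \<in> false_eisenstein_algebra.
            f holomorphic_on \<H> \<and> qD f \<in> false_eisenstein_algebra) \<and>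
         (\<forall>k\<ge>1. \<forall>\<tau>\<in>\<H>.
            qD (false_eisenstein k) \<tau> =
              false_eisenstein (k + 2) \<tau> / 6
              - 1/6 * (\<Sum>d=0..k. of_nat (k choose d)
                        * false_eisenstein (d + 1) \<tau> * false_eisenstein (k - d + 1) \<tau>)) \<and>
         (\<forall>\<tau>\<in>\<H>.
            false_eisenstein 2 \<tau> / 6 - (false_eisenstein 1 \<tau>)\<^sup>2 / 6 = eisenstein_G 2 \<tau>) \<and>
         false_eisenstein_algebra =
           fun_algebra (quasimodular_forms \<union> {false_eisenstein k | k. odd k})"
proof (intro conjI ballI allI impI)
  fix f assume f: "f \<in> false_eisenstein_algebra"
  show "f holomorphic_on \<H>"
    using false_eisenstein_algebra_deriv[OF f]
    by (auto simp: holomorphic_on_def intro: field_differentiable_at_within)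
  show "qD f \<in> false_eisenstein_algebra"
    using false_eisenstein_algebra_deriv[OF f] by blast
qed (use qD_false_eisenstein false_eisenstein_2 false_eisenstein_algebra_eq in auto)

end
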